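(* Let $\mathcal{H}$ be a separable infinite-dimensional real Hilbert space, $X$ an isonormal Gaussian process on $\mathcal{H}$ defined on $(\Omega,\mathcal{F},\mathbb{P})$, and $K\subset\mathcal{H}$ a GB convex body. Let $\mu_K$ be the probability measure on the set $\mathrm{Ext}(K)$ of extremal points of $K$ obtained as the pushforward of $\mathbb{P}$ under $\omega\mapsto Dh_K(X)(\omega)$. Then the Steiner point $\mathrm{Stein}(K)$ is the barycenter of $\mu_K$.
   Context: An isonormal Gaussian process on $\mathcal{H}$ is a family $X=(X_v)_{v\in\mathcal{H}}$ of centred jointly Gaussian random variables with $\mathbb{E}[X_vX_u]=(v,u)_{\mathcal{H}}$ and $X_{av+bu}=aX_v+bX_u$. A convex body in $\mathcal{H}$ is a non-empty compact convex subset; it is Gaussian bounded (GB) if for every countable $C\subset K$, $\sup_{v\in C}X_v<\infty$ almost surely. The support function is $h_K(X)=\sup_{v\in K}X_v$ (supremum over any countable dense subset of $K$). Malliavin derivative: for $\varphi=f(X_{v_1},\dots,X_{v_n})$ with $f$ smooth and all its derivatives of at most polynomial growth, $D\varphi=\sum_j\partial_jf(X_{v_1},\dots,X_{v_n})v_j$; $D$ also denotes the closure of this operator from $L^2(\Omega)$ to $L^2(\Omega;\mathcal{H})$, with domain $\mathbb{D}^{1,2}$. For every GB convex body $K$, $h_K(X)\in\mathbb{D}^{1,2}$, and $Dh_K(X)$ takes values almost surely in $\mathrm{Ext}(K)$. The Steiner point $\mathrm{Stein}(K)\in\mathcal{H}$ is determined by $(\mathrm{Stein}(K),v)_{\mathcal{H}}=\mathbb{E}[h_K(X)X_v]$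 for all $v\in\mathcal{H}$. The barycenter of a probability measure $\mu$ on $\mathrm{Ext}(K)$ is the unique point $b\in K$ such that $\int_{\mathrm{Ext}(K)}\phi(v)\,d\mu(v)=\phi(b)$ for every (continuous) affine function $\phi$ on $\mathcal{H}$.
   Formalization: It is assumed that Dh_K(X) takes values almost surely in Ext(K), so that μ_K is a probability measure on Ext(K); this can fail for some GB convex bodies, for which μ_K as described does not exist. *)

theory Defs
  imports "HOL-Probability.Probability"
begin

definition centred_gaussian :: "'w measure \<Rightarrow> ('w \<Rightarrow> real) \<Rightarrow> bool" where
  "centred_gaussian M Y \<longleftrightarrow> Y \<in> borel_measurable M \<and>
     ((AE \<omega> in M. Y \<omega> = 0) \<or> (\<exists>\<sigma>>0. distributed M lborel Y (normal_density 0 \<sigma>)))"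

(* Joint Gaussianity of a family: every finite linear combination is Gaussian, possibly degenerate. *)
definition isonormal_gaussian_process ::
    "'w measure \<Rightarrow> ('h::real_inner \<Rightarrow> 'w \<Rightarrow> real) \<Rightarrow> bool" where
  "isonormal_gaussian_process M X \<longleftrightarrow>
     (\<forall>v. X v \<in> borel_measurable M) \<and>
     (\<forall>S c. finite S \<longrightarrow> centred_gaussian M (\<lambda>\<omega>. \<Sum>v\<in>S. c v * X v \<omega>)) \<and>
     (\<forall>v u. (LINT \<omega>|M. X v \<omega> * X u \<omega>) = v \<bullet> u) \<and>
     (\<forall>a b v u. AE \<omega> in M. X (a *\<^sub>R v + b *\<^sub>R u) \<omega> = a * X v \<omega> + b * X u \<omega>)"

definition convex_body :: "'h::real_normed_vector set \<Rightarrow> bool" where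
  "convex_body K \<longleftrightarrow> K \<noteq> {} \<and> compact K \<and> convex K"

definition gaussian_bounded :: "'w measure \<Rightarrow> ('h \<Rightarrow> 'w \<Rightarrow> real) \<Rightarrow> 'h set \<Rightarrow> bool" where
  "gaussian_bounded M X K \<longleftrightarrow>
     (\<forall>C. countable C \<and> C \<subseteq> K \<longrightarrow> (AE \<omega> in M. bdd_above ((\<lambda>v. X v \<omega>) ` C)))"

definition countable_dense_subset :: "'h::topological_space set \<Rightarrow> 'h set \<Rightarrow> bool" where
  "countable_dense_subset C K \<longleftrightarrow> countable C \<and> C \<subseteq> K \<and> K \<subseteq> closure C"

(* For a GB convex body K, h_K(X) is support_function X C with C any countable dense subset of K;
   different choices of C give almost surely equal random variables. *)
definition support_function :: "('h \<Rightarrow> 'w \<Rightarrow> real) \<Rightarrow> 'h set \<Rightarrow> 'w \<Rightarrow> real" where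
  "support_function X C \<omega> = (SUP v\<in>C. X v \<omega>)"

(* A function on R^n is represented by a function of sequences that ignores all coordinates
   with index at least n. *)
definition depends_on_first :: "nat \<Rightarrow> ((nat \<Rightarrow> real) \<Rightarrow> real) \<Rightarrow> bool" where
  "depends_on_first n f \<longleftrightarrow> (\<forall>x y. (\<forall>i<n. x i = y i) \<longrightarrow> f x = f y)"

definition partial_deriv :: "nat \<Rightarrow> ((nat \<Rightarrow> real) \<Rightarrow> real) \<Rightarrow> (nat \<Rightarrow> real) \<Rightarrow> real" where
  "partial_deriv i f x = deriv (\<lambda>t. f (x(i := t))) (x i)"

fun iterated_partial :: "nat list \<Rightarrow> ((nat \<Rightarrow> real) \<Rightarrow> real) \<Rightarrow> (nat \<Rightarrow> real) \<Rightarrow> real" where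
  "iterated_partial [] f = f"
| "iterated_partial (i # is) f = partial_deriv i (iterated_partial is f)"

definition smooth_poly_growth :: "nat \<Rightarrow> ((nat \<Rightarrow> real) \<Rightarrow> real) \<Rightarrow> bool" where
  "smooth_poly_growth n f \<longleftrightarrow> depends_on_first n f \<and>
     (\<forall>is. set is \<subseteq> {..<n} \<longrightarrow>
        continuous_on UNIV (iterated_partial is f) \<and>
        (\<forall>i<n. \<forall>x. (\<lambda>t. iterated_partial is f (x(i := t))) differentiable (at (x i))) \<and>
        (\<exists>A m. \<forall>x. \<bar>iterated_partial is f x\<bar> \<le> A * (1 + (\<Sum>i<n. \<bar>x i\<bar>)) ^ m))"

definition smooth_malliavin_derivative ::
    "('h::real_inner \<Rightarrow> 'w \<Rightarrow> real) \<Rightarrow> ('w \<Rightarrow> real) \<Rightarrow> ('w \<Rightarrow> 'h) \<Rightarrow> bool" where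
  "smooth_malliavin_derivative X \<phi> G \<longleftrightarrow>
     (\<exists>n (v :: nat \<Rightarrow> 'h) f. smooth_poly_growth n f \<and>
        \<phi> = (\<lambda>\<omega>. f (\<lambda>i. X (v i) \<omega>)) \<and>
        G = (\<lambda>\<omega>. \<Sum>j<n. partial_deriv j f (\<lambda>i. X (v i) \<omega>) *\<^sub>R v j))"

(* The graph of the closure of the operator above from L^2(Omega) to L^2(Omega; H), at the level
   of representatives: phi lies in D^{1,2} and G is a version of its Malliavin derivative. *)
definition has_malliavin_derivative ::
    "'w measure \<Rightarrow> ('h::{real_inner,polish_space} \<Rightarrow> 'w \<Rightarrow> real) \<Rightarrow> ('w \<Rightarrow> real) \<Rightarrow> ('w \<Rightarrow> 'h) \<Rightarrow> bool"
where
  "has_malliavin_derivative M X \<phi> G \<longleftrightarrow>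
     \<phi> \<in> borel_measurable M \<and> integrable M (\<lambda>\<omega>. (\<phi> \<omega>)\<^sup>2) \<and>
     G \<in> borel_measurable M \<and> integrable M (\<lambda>\<omega>. (norm (G \<omega>))\<^sup>2) \<and>
     (\<exists>\<phi>s Gs. (\<forall>k :: nat. smooth_malliavin_derivative X (\<phi>s k) (Gs k)) \<and>
        (\<lambda>k. \<integral>\<^sup>+\<omega>. ennreal ((\<phi>s k \<omega> - \<phi> \<omega>)\<^sup>2) \<partial>M) \<longlonglongrightarrow> 0 \<and>
        (\<lambda>k. \<integral>\<^sup>+\<omega>. ennreal ((norm (Gs k \<omega> - G \<omega>))\<^sup>2) \<partial>M) \<longlonglongrightarrow> 0)"

definition steiner_point ::
    "'w measure \<Rightarrow> ('h::real_inner \<Rightarrow> 'w \<Rightarrow> real) \<Rightarrow> 'h set \<Rightarrow> 'h" where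
  "steiner_point M X K =
     (THE s. \<forall>C. countable_dense_subset C K \<longrightarrow>
        (\<forall>v. s \<bullet> v = (LINT \<omega>|M. support_function X C \<omega> * X v \<omega>)))"

definition extremal_points :: "'h::real_vector set \<Rightarrow> 'h set" where
  "extremal_points K = {x. x extreme_point_of K}"

(* The law of G as a measure on Ext(K) with its trace Borel sigma-algebra. *)
definition law_on_extremal_points ::
    "'w measure \<Rightarrow> 'h::real_normed_vector set \<Rightarrow> ('w \<Rightarrow> 'h) \<Rightarrow> 'h measure" where
  "law_on_extremal_points M K G = restrict_space (distr M borel G) (extremal_points K)"

definition affine_function :: "('h::real_vector \<Rightarrow> real) \<Rightarrow> bool" where
  "affine_function \<phi> \<longleftrightarrow> (\<forall>x y t. \<phi> ((1 - t) *\<^sub>R x + t *\<^sub>R y) = (1 - t) * \<phi> x + t * \<phi> y)"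

definition represents_barycenter :: "'h::real_normed_vector measure \<Rightarrow> 'h \<Rightarrow> bool" where
  "represents_barycenter \<mu> b \<longleftrightarrow>
     (\<forall>\<phi>. affine_function \<phi> \<and> continuous_on UNIV \<phi> \<longrightarrow>
        integrable \<mu> \<phi> \<and> (LINT v|\<mu>. \<phi> v) = \<phi> b)"

(* mu is a probability measure on Ext(K), and b is the unique point of K representing it. *)
definition is_barycenter ::
    "'h::real_normed_vector set \<Rightarrow> 'h measure \<Rightarrow> 'h \<Rightarrow> bool" where
  "is_barycenter K \<mu> b \<longleftrightarrow>
     prob_space \<mu> \<and> space \<mu> = extremal_points K \<and>
     b \<in> K \<and> represents_barycenter \<mu> b \<and> (\<forall>b'\<in>K. represents_barycenter \<mu> b' \<longrightarrow> b' = b)"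

end

theory Submission
  imports Defs
begin

text \<open>The theorem says that the Steiner point is the mean of the random vector $Dh_K(X)$, and the reason
  is Gaussian integration by parts: $E[\varphi X_w] = E[(D\varphi, w)]$ for every $\varphi$ in the
  domain of the Malliavin derivative (\<open>malliavin_derivative_duality\<close>). For $\varphi = h_K(X)$ the
  left side is $(\mathrm{Stein}(K), w)$ by the definition of the Steiner point, so the Steiner point
  has the same inner products as the mean of $Dh_K(X)$. A random point of a compact convex set has a
  mean in that set which commutes with every continuous affine function (\<open>barycenter_exists\<close>), and
  this mean is the barycenter of the law. It is the only barycenter because the affine functions
  $x \mapsto (x, v)$ separate points.

  The mean is obtained without a vector-valued integral: averages over finer and finer nets in $K$
  lie in $K$, and compactness gives them a limit point. Compactness and convexity also make the set
  of extreme points Borel, so that the law of $Dh_K(X)$ restricts to it.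

  Integration by parts is first proved for $\varphi = f(X_{v_1}, \dots, X_{v_n})$ and a unit vector
  $w$. Split $v_i = v_i' + (v_i, w) w$ with $v_i'$ orthogonal to $w$. The joint law of the $X_{v_i}$
  and $X_w$ is then that of $X_{v_i'} + (v_i, w) t$ and $t$, where $t$ is a standard normal variable on
  a second factor of a product space (\<open>law_decoupled_along_unit_vector\<close>). With the first factor
  fixed, integration by parts in the one variable $t$ and the chain rule along a line give the
  formula. That the two joint laws agree follows from equality of their characteristic functions,
  by a finite-dimensional version of Levy's uniqueness theorem (\<open>joint_law_determined_by_cosines\<close>).
  The formula passes to the closure of $D$ because both of its sides are continuous in $L^2$.

  Finally, $h_K(X)$ must not depend on the countable dense set over which the supremum is taken:
  along a sequence $u_n \to v$ the variables $X_{u_n}$ tend to $X_v$ in $L^2$, hence almost surely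
  along a subsequence (\<open>support_function_AE_unique\<close>).\<close>

section \<open>Barycenters of random points of a compact convex set\<close>

text \<open>A point of $K$ fails to be extreme exactly when it is the midpoint of two distinct points of $K$.
  The pairs at distance at least $1/(n+1)$ form a compact set, so the non-extreme points are a
  countable union of compact sets.\<close>

lemma extremal_points_borel:
  fixes K :: "'a::real_normed_vector set"
  assumes "compact K" "convex K"
  shows "extremal_points K \<in> sets borel"
proof -
  define P where "P n = {p \<in> K \<times> K. 1 / real (Suc n) \<le> dist (fst p) (snd p)}" for n :: nat
  define mid where "mid p = midpoint (fst p) (snd p)" for p :: "'a \<times> 'a"
  have cont: "continuous_on S mid" for S
    unfolding mid_def midpoint_def by (intro continuous_intros)
  have cP: "compact (P n)" for n
  proof -
    have "closed {p :: 'a \<times> 'a. 1 / real (Suc n) \<le> dist (fst p) (snd p)}"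
      by (intro closed_Collect_le continuous_intros)
    moreover have "P n = (K \<times> K) \<inter> {p. 1 / real (Suc n) \<le> dist (fst p) (snd p)}"
      by (auto simp: P_def)
    ultimately show ?thesis
      using assms(1) by (simp add: compact_Int_closed compact_Times)
  qed
  have meas: "(\<Union>n. mid ` P n) \<in> sets borel"
    using compact_continuous_image[OF cont cP]
    by (intro sets.countable_UN) (auto intro: borel_closed compact_imp_closed)
  have "extremal_points K = K - (\<Union>n. mid ` P n)"
  proof (intro equalityI subsetI)
    fix x assume x: "x \<in> extremal_points K"
    then have xK: "x \<in> K" and ext: "\<And>a b. a \<in> K \<Longrightarrow> b \<in> K \<Longrightarrow> x \<notin> open_segment a b"
      by (auto simp: extremal_points_def extreme_point_of_def)
    have "x \<noteq> mid p" if "p \<in> P n" for n p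
    proof
      assume "x = mid p"
      have "0 < 1 / real (Suc n)" by simp
      with that have "fst p \<noteq> snd p"
        by (auto simp: P_def)
      then have "mid p \<in> open_segment (fst p) (snd p)"
        by (simp add: mid_def)
      with ext that \<open>x = mid p\<close> show False by (auto simp: P_def)
    qed
    with xK show "x \<in> K - (\<Union>n. mid ` P n)" by blast
  next
    fix x assume x: "x \<in> K - (\<Union>n. mid ` P n)"
    have "x \<notin> open_segment a b" if ab: "a \<in> K" "b \<in> K" for a b
    proof
      assume "x \<in> open_segment a b"
      then obtain u where ne: "a \<noteq> b" and u: "0 < u" "u < 1" and xu: "x = (1 - u) *\<^sub>R a + u *\<^sub>R b"
        by (auto simp: in_segment)
      \<comment> \<open>A subsegment of the segment from a to b that is centred at x.\<close>
      define d where "d = min u (1 - u)"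
      have d: "0 < d" "d \<le> u" "d \<le> 1 - u" using u by (auto simp: d_def)
      define y where "y = (1 - (u - d)) *\<^sub>R a + (u - d) *\<^sub>R b"
      define z where "z = (1 - (u + d)) *\<^sub>R a + (u + d) *\<^sub>R b"
      have yz: "y \<in> K" "z \<in> K"
        unfolding y_def z_def using d assms(2) ab by (auto intro!: convexD)
      have "z - y = d *\<^sub>R (b - a) + d *\<^sub>R (b - a)"
        by (simp add: y_def z_def algebra_simps)
      then have "z - y \<noteq> 0"
        using d ne by (simp only: scaleR_left_distrib[symmetric] scaleR_eq_0_iff) simp
      then have "0 < dist y z" by auto
      then obtain n where "1 / real (Suc n) < dist y z"
        using reals_Archimedean[of "dist y z"] unfolding inverse_eq_divide by blast
      then have "(y, z) \<in> P n" using yz by (auto simp: P_def)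
      moreover have "y + z = x + x"
        by (simp add: y_def z_def xu algebra_simps)
      then have "mid (y, z) = x"
        by (simp add: mid_def midpoint_def inverse_eq_divide)
      ultimately show False using x by blast
    qed
    with x show "x \<in> extremal_points K"
      by (auto simp: extremal_points_def extreme_point_of_def)
  qed
  with meas assms(1) show ?thesis
    by (simp add: borel_closed compact_imp_closed sets.Diff)
qed

lemma affine_function_convex_sum:
  assumes "affine_function \<phi>" "finite S" "(\<Sum>i\<in>S. c i) = 1"
  shows "\<phi> (\<Sum>i\<in>S. c i *\<^sub>R x i) = (\<Sum>i\<in>S. c i * \<phi> (x i))"
proof -
  define L where "L x = \<phi> x - \<phi> 0" for x
  have aff: "\<phi> ((1 - t) *\<^sub>R x + t *\<^sub>R y) = (1 - t) * \<phi> x + t * \<phi> y" for x y t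
    using assms(1) by (auto simp: affine_function_def)
  have Ls: "L (t *\<^sub>R x) = t * L x" for t x
    using aff[of t 0 x] by (simp add: L_def algebra_simps)
  have La: "L (x + y) = L x + L y" for x y
  proof -
    have "L (x + y) = 2 * L ((1/2) *\<^sub>R (x + y))"
      by (simp add: Ls)
    also have "\<dots> = L x + L y"
      using aff[of "1/2" x y] by (simp add: L_def scaleR_add_right)
    finally show ?thesis .
  qed
  have "L (\<Sum>i\<in>S. c i *\<^sub>R x i) = (\<Sum>i\<in>S. c i * L (x i))"
    using \<open>finite S\<close> by induction (simp_all add: La Ls, simp add: L_def)
  also have "\<dots> = (\<Sum>i\<in>S. c i * \<phi> (x i)) - (\<Sum>i\<in>S. c i) * \<phi> 0"
    by (simp add: L_def right_diff_distrib sum_subtractf sum_distrib_right)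
  finally show ?thesis
    using assms(3) by (simp add: L_def)
qed

text \<open>Replace $G$ by a random variable that takes finitely many values, all in $K$ and each within
  $\varepsilon$ of $G$. Its mean is a finite convex combination, with which every affine function
  commutes, and the error is bounded by the oscillation of the function at scale $\varepsilon$.\<close>

lemma (in prob_space) approximate_barycenter:
  fixes G :: "'a \<Rightarrow> 'b::{real_normed_vector, second_countable_topology}"
  assumes K: "compact K" "convex K"
    and G[measurable]: "G \<in> borel_measurable M" and GK: "\<And>\<omega>. G \<omega> \<in> K"
    and "0 < \<epsilon>"
  shows "\<exists>s\<in>K. \<forall>\<phi> \<delta>. affine_function \<phi> \<longrightarrow> continuous_on UNIV \<phi> \<longrightarrow>
    (\<forall>x\<in>K. \<forall>y\<in>K. dist x y < \<epsilon> \<longrightarrow> \<bar>\<phi> x - \<phi> y\<bar> \<le> \<delta>) \<longrightarrow> \<bar>\<phi> s - expectation (\<lambda>\<omega>. \<phi> (G \<omega>))\<bar> \<le> \<delta>"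
proof -
  obtain F where F: "finite F" "F \<subseteq> K" "K \<subseteq> (\<Union>x\<in>F. ball x \<epsilon>)"
    using compactE_image[OF K(1), of K "\<lambda>x. ball x \<epsilon>"] \<open>0 < \<epsilon>\<close>
    by (metis (no_types, lifting) UN_I centre_in_ball open_ball subsetI)
  obtain xs where xs: "set xs = F" using finite_list[OF F(1)] by blast
  let ?n = "length xs"
  \<comment> \<open>The index of the first net point that is close to G.\<close>
  define T where "T \<omega> = (LEAST i. i < ?n \<and> dist (xs ! i) (G \<omega>) < \<epsilon>)" for \<omega>
  have ex: "\<exists>i. i < ?n \<and> dist (xs ! i) (G \<omega>) < \<epsilon>" for \<omega>
    using F(3) GK[of \<omega>] xs by (fastforce simp: in_set_conv_nth)
  have T: "T \<omega> < ?n" "dist (xs ! T \<omega>) (G \<omega>) < \<epsilon>" for \<omega>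
    using LeastI_ex[OF ex] unfolding T_def by auto
  have [measurable]: "T \<in> measurable M (count_space UNIV)"
    unfolding T_def by measurable
  define c where "c i = prob {\<omega>\<in>space M. T \<omega> = i}" for i
  have int: "integrable M (indicat_real {\<omega>\<in>space M. T \<omega> = i})" for i
    by (intro integrable_real_indicator) (auto simp: less_top[symmetric])
  have E: "expectation (\<lambda>\<omega>. g (T \<omega>)) = (\<Sum>i<?n. c i * g i)" for g :: "nat \<Rightarrow> real"
  proof -
    have "expectation (\<lambda>\<omega>. g (T \<omega>)) = expectation (\<lambda>\<omega>. \<Sum>i<?n. indicator {\<omega>\<in>space M. T \<omega> = i} \<omega> * g i)"
    proof (rule Bochner_Integration.integral_cong[OF refl])
      fix \<omega> assume "\<omega> \<in> space M"
      then have "(\<Sum>i<?n. indicator {\<omega>\<in>space M. T \<omega> = i} \<omega> * g i) = (\<Sum>i<?n. if T \<omega> = i then g i else 0)"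
        by (intro sum.cong) (auto simp: indicator_def)
      also have "\<dots> = g (T \<omega>)" using T(1)[of \<omega>] by simp
      finally show "g (T \<omega>) = (\<Sum>i<?n. indicator {\<omega>\<in>space M. T \<omega> = i} \<omega> * g i)" by simp
    qed
    also have "\<dots> = (\<Sum>i<?n. c i * g i)"
      using int by (subst Bochner_Integration.integral_sum) (auto simp: c_def)
    finally show ?thesis .
  qed
  have c1: "(\<Sum>i<?n. c i) = 1" using E[of "\<lambda>_. 1"] prob_space by simp
  define s where "s = (\<Sum>i<?n. c i *\<^sub>R xs ! i)"
  have "s \<in> K" unfolding s_def
    using c1 F xs by (intro convex_sum[OF _ K(2)]) (auto simp: c_def)
  moreover have "\<bar>\<phi> s - expectation (\<lambda>\<omega>. \<phi> (G \<omega>))\<bar> \<le> \<delta>"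
    if \<phi>: "affine_function \<phi>" "continuous_on UNIV \<phi>"
      and \<delta>: "\<forall>x\<in>K. \<forall>y\<in>K. dist x y < \<epsilon> \<longrightarrow> \<bar>\<phi> x - \<phi> y\<bar> \<le> \<delta>" for \<phi> \<delta>
  proof -
    have [measurable]: "\<phi> \<in> borel_measurable borel"
      using \<phi>(2) by (rule borel_measurable_continuous_onI)
    obtain B where B: "\<And>x. x \<in> K \<Longrightarrow> norm (\<phi> x) \<le> B"
      using compact_imp_bounded[OF compact_continuous_image[OF continuous_on_subset[OF \<phi>(2)] K(1)]]
      by (auto simp: bounded_iff)
    have i1: "integrable M (\<lambda>\<omega>. \<phi> (G \<omega>))"
      using B GK by (intro integrable_const_bound[where B=B]) auto
    have i2: "integrable M (\<lambda>\<omega>. \<phi> (xs ! T \<omega>))"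
    proof (rule integrable_const_bound[where B=B])
      have "xs ! T \<omega> \<in> K" for \<omega>
        using T(1) F(2) xs nth_mem by blast
      with B show "AE \<omega> in M. norm (\<phi> (xs ! T \<omega>)) \<le> B" by blast
    qed simp
    have "\<phi> s = expectation (\<lambda>\<omega>. \<phi> (xs ! T \<omega>))"
      unfolding s_def using E[of "\<lambda>i. \<phi> (xs ! i)"] affine_function_convex_sum[OF \<phi>(1) _ c1] by simp
    then have "\<bar>\<phi> s - expectation (\<lambda>\<omega>. \<phi> (G \<omega>))\<bar> = \<bar>expectation (\<lambda>\<omega>. \<phi> (xs ! T \<omega>) - \<phi> (G \<omega>))\<bar>"
      using i1 i2 by simp
    also have "\<dots> \<le> expectation (\<lambda>\<omega>. \<bar>\<phi> (xs ! T \<omega>) - \<phi> (G \<omega>)\<bar>)"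
      by (rule integral_abs_bound)
    also have "\<dots> \<le> expectation (\<lambda>\<omega>. \<delta>)"
    proof (rule integral_mono)
      show "integrable M (\<lambda>\<omega>. \<bar>\<phi> (xs ! T \<omega>) - \<phi> (G \<omega>)\<bar>)" using i1 i2 by simp
      show "\<bar>\<phi> (xs ! T \<omega>) - \<phi> (G \<omega>)\<bar> \<le> \<delta>" for \<omega>
        using \<delta> T[of \<omega>] GK[of \<omega>] F(2) xs nth_mem[OF T(1)] by blast
    qed simp
    also have "\<dots> = \<delta>" using prob_space by simp
    finally show ?thesis .
  qed
  ultimately show ?thesis by blast
qed

text \<open>A continuous function is uniformly continuous on $K$, so the error of the approximate barycenters
  tends to zero, and any limit point of them has the required property for all affine functions at
  once.\<close>

lemma (in prob_space) barycenter_exists: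
  fixes G :: "'a \<Rightarrow> 'b::{real_normed_vector, second_countable_topology}"
  assumes K: "compact K" "convex K"
    and G[measurable]: "G \<in> borel_measurable M" and GK: "AE \<omega> in M. G \<omega> \<in> K"
  shows "\<exists>s\<in>K. \<forall>\<phi>. affine_function \<phi> \<longrightarrow> continuous_on UNIV \<phi> \<longrightarrow>
    integrable M (\<lambda>\<omega>. \<phi> (G \<omega>)) \<and> expectation (\<lambda>\<omega>. \<phi> (G \<omega>)) = \<phi> s"
proof -
  have [measurable]: "K \<in> sets borel" using K(1) by (simp add: borel_closed compact_imp_closed)
  obtain x0 where x0: "x0 \<in> K"
    using AE_False GK by (cases "K = {}") (auto simp: prob_space)
  \<comment> \<open>A version of G with all its values in K.\<close>
  define H where "H \<omega> = (if G \<omega> \<in> K then G \<omega> else x0)" for \<omega>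
  have H[measurable]: "H \<in> borel_measurable M" unfolding H_def by measurable
  have HK: "H \<omega> \<in> K" for \<omega> using x0 by (simp add: H_def)
  have HG: "AE \<omega> in M. H \<omega> = G \<omega>" using GK by eventually_elim (simp add: H_def)
  have "\<exists>s\<in>K. \<forall>\<phi> \<delta>. affine_function \<phi> \<longrightarrow> continuous_on UNIV \<phi> \<longrightarrow>
    (\<forall>x\<in>K. \<forall>y\<in>K. dist x y < 1 / Suc n \<longrightarrow> \<bar>\<phi> x - \<phi> y\<bar> \<le> \<delta>) \<longrightarrow> \<bar>\<phi> s - expectation (\<lambda>\<omega>. \<phi> (H \<omega>))\<bar> \<le> \<delta>" for n
    by (rule approximate_barycenter[OF K H HK]) simp
  then obtain s where sK: "\<And>n. s n \<in> K" and s: "\<And>n \<phi> \<delta>. affine_function \<phi> \<Longrightarrow> continuous_on UNIV \<phi> \<Longrightarrow>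
    (\<forall>x\<in>K. \<forall>y\<in>K. dist x y < 1 / Suc n \<longrightarrow> \<bar>\<phi> x - \<phi> y\<bar> \<le> \<delta>) \<Longrightarrow> \<bar>\<phi> (s n) - expectation (\<lambda>\<omega>. \<phi> (H \<omega>))\<bar> \<le> \<delta>"
    by metis
  obtain l r where l: "l \<in> K" and r: "strict_mono (r :: nat \<Rightarrow> nat)" and lim: "(s \<circ> r) \<longlonglongrightarrow> l"
    using K(1) sK unfolding compact_eq_seq_compact_metric seq_compact_def by metis
  have "integrable M (\<lambda>\<omega>. \<phi> (G \<omega>)) \<and> expectation (\<lambda>\<omega>. \<phi> (G \<omega>)) = \<phi> l"
    if \<phi>: "affine_function \<phi>" "continuous_on UNIV \<phi>" for \<phi>
  proof
    have [measurable]: "\<phi> \<in> borel_measurable borel"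
      using \<phi>(2) by (rule borel_measurable_continuous_onI)
    have contK: "continuous_on K \<phi>" using \<phi>(2) continuous_on_subset by blast
    obtain B where B: "\<And>x. x \<in> K \<Longrightarrow> norm (\<phi> x) \<le> B"
      using compact_imp_bounded[OF compact_continuous_image[OF contK K(1)]]
      by (auto simp: bounded_iff)
    show "integrable M (\<lambda>\<omega>. \<phi> (G \<omega>))"
      using GK B by (intro integrable_const_bound[where B=B]) auto
    have eq: "expectation (\<lambda>\<omega>. \<phi> (G \<omega>)) = expectation (\<lambda>\<omega>. \<phi> (H \<omega>))"
      using HG by (intro integral_cong_AE) auto
    have lim1: "(\<lambda>n. \<phi> (s (r n))) \<longlonglongrightarrow> \<phi> l"
      using continuous_on_tendsto_compose[OF \<phi>(2) lim] by (simp add: o_def)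
    have lim2: "(\<lambda>n. \<phi> (s (r n))) \<longlonglongrightarrow> expectation (\<lambda>\<omega>. \<phi> (H \<omega>))"
    proof (rule LIMSEQ_I)
      fix e :: real assume "0 < e"
      then obtain d where d: "0 < d" "\<And>x y. x \<in> K \<Longrightarrow> y \<in> K \<Longrightarrow> dist y x < d \<Longrightarrow> dist (\<phi> y) (\<phi> x) < e / 2"
        using compact_uniformly_continuous[OF contK K(1)]
        unfolding uniformly_continuous_on_def by (metis half_gt_zero)
      obtain N where N: "1 / real (Suc N) < d"
        using reals_Archimedean[OF d(1)] unfolding inverse_eq_divide by blast
      have "norm (\<phi> (s (r n)) - expectation (\<lambda>\<omega>. \<phi> (H \<omega>))) < e" if "n \<ge> N" for n
      proof -
        have "N \<le> r n" using that seq_suble[OF r, of n] by simp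
        then have "1 / real (Suc (r n)) \<le> 1 / real (Suc N)" by (simp add: frac_le)
        with N have "1 / real (Suc (r n)) < d" by simp
        then have "\<bar>\<phi> (s (r n)) - expectation (\<lambda>\<omega>. \<phi> (H \<omega>))\<bar> \<le> e / 2"
          using d(2) by (intro s \<phi>) (force simp: dist_real_def)
        with \<open>0 < e\<close> show ?thesis by simp
      qed
      then show "\<exists>no. \<forall>n\<ge>no. norm (\<phi> (s (r n)) - expectation (\<lambda>\<omega>. \<phi> (H \<omega>))) < e" by blast
    qed
    show "expectation (\<lambda>\<omega>. \<phi> (G \<omega>)) = \<phi> l"
      using LIMSEQ_unique[OF lim1 lim2] eq by simp
  qed
  with l show ?thesis by blast
qed

section \<open>Uniqueness of finite-dimensional laws\<close>

text \<open>Levy's uniqueness theorem for the signed measures $E[W ; Y \in \cdot]$. Adding the constant 2 to the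
  weight makes it at least 1, so that after division by its mean it becomes a probability density,
  to which the theorem for probability measures applies. The extra term $2 P(Y \in A)$ is subtracted
  again by the same argument for the constant weight 2.\<close>

lemma borel_events_determined_by_weighted_characteristic:
  fixes Y :: "'a \<Rightarrow> real" and Y' :: "'b \<Rightarrow> real"
  assumes "prob_space M" "prob_space N"
    and [measurable]: "Y \<in> borel_measurable M" "Y' \<in> borel_measurable N"
      "W \<in> borel_measurable M" "W' \<in> borel_measurable N"
    and W: "\<And>x. \<bar>W x\<bar> \<le> 1" and W': "\<And>x. \<bar>W' x\<bar> \<le> 1"
    and c1: "\<And>s. (LINT x|M. cos (s * Y x)) = (LINT x|N. cos (s * Y' x))"
    and s1: "\<And>s. (LINT x|M. sin (s * Y x)) = (LINT x|N. sin (s * Y' x))"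
    and cW: "\<And>s. (LINT x|M. W x * cos (s * Y x)) = (LINT x|N. W' x * cos (s * Y' x))"
    and sW: "\<And>s. (LINT x|M. W x * sin (s * Y x)) = (LINT x|N. W' x * sin (s * Y' x))"
    and A: "A \<in> sets borel"
  shows "(LINT x|M. W x * indicator A (Y x)) = (LINT x|N. W' x * indicator A (Y' x))"
proof -
  interpret M: prob_space M by fact
  interpret N: prob_space N by fact
  have key: "(LINT x|M. V x * indicator A (Y x)) = (LINT x|N. V' x * indicator A (Y' x))"
    if [measurable]: "V \<in> borel_measurable M" "V' \<in> borel_measurable N"
    and V: "\<And>x. 1 \<le> V x" "\<And>x. V x \<le> 3" and V': "\<And>x. 1 \<le> V' x" "\<And>x. V' x \<le> 3"
    and cV: "\<And>s. (LINT x|M. V x * cos (s * Y x)) = (LINT x|N. V' x * cos (s * Y' x))"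
    and sV: "\<And>s. (LINT x|M. V x * sin (s * Y x)) = (LINT x|N. V' x * sin (s * Y' x))" for V V'
  proof -
    define c where "c = (LINT x|M. V x)"
    have iV: "integrable M V" 
    proof (rule M.integrable_const_bound[where B=3])
      show "AE x in M. norm (V x) \<le> 3" using V order_trans[OF zero_le_one V(1)] by simp
    qed simp
    have iV': "integrable N V'" 
    proof (rule N.integrable_const_bound[where B=3])
      show "AE x in N. norm (V' x) \<le> 3" using V' order_trans[OF zero_le_one V'(1)] by simp
    qed simp
    have c: "c = (LINT x|N. V' x)" using cV[of 0] by (simp add: c_def)
    have "(LINT x|M. 1) \<le> c" unfolding c_def using iV V by (intro integral_mono) auto
    then have c1: "1 \<le> c" by (simp add: M.prob_space)
    define L where "L = distr (density M (\<lambda>x. ennreal (V x / c))) borel Y"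
    define L' where "L' = distr (density N (\<lambda>x. ennreal (V' x / c))) borel Y'"
    have int: "(LINT y|L. g y) = (LINT x|M. V x * g (Y x)) / c"
      if [measurable]: "g \<in> borel_measurable borel" for g :: "real \<Rightarrow> real"
      unfolding L_def using V c1 order_trans[OF zero_le_one V(1)]
      by (subst integral_distr) (auto simp: integral_density)
    have int': "(LINT y|L'. g y) = (LINT x|N. V' x * g (Y' x)) / c"
      if [measurable]: "g \<in> borel_measurable borel" for g :: "real \<Rightarrow> real"
      unfolding L'_def using V' c1 order_trans[OF zero_le_one V'(1)]
      by (subst integral_distr) (auto simp: integral_density)
    have "emeasure (density M (\<lambda>x. ennreal (V x / c))) (space M) = 1"
    proof -
      have "(\<integral>\<^sup>+x. ennreal (V x / c) \<partial>M) = ennreal (LINT x|M. V x / c)"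
        using iV c1 order_trans[OF zero_le_one V(1)] by (intro nn_integral_eq_integral) auto
      then show ?thesis using c1 by (simp add: emeasure_density c_def[symmetric])
    qed
    then have rL: "real_distribution L"
      unfolding L_def by (intro prob_space.real_distribution_distr prob_spaceI) auto
    have "emeasure (density N (\<lambda>x. ennreal (V' x / c))) (space N) = 1"
    proof -
      have "(\<integral>\<^sup>+x. ennreal (V' x / c) \<partial>N) = ennreal (LINT x|N. V' x / c)"
        using iV' c1 order_trans[OF zero_le_one V'(1)] by (intro nn_integral_eq_integral) auto
      then show ?thesis using c1 by (simp add: emeasure_density c[symmetric])
    qed
    then have rL': "real_distribution L'"
      unfolding L'_def by (intro prob_space.real_distribution_distr prob_spaceI) auto
    interpret L: real_distribution L by fact
    interpret L': real_distribution L' by fact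
    have "char L = char L'"
    proof
      fix t
      have ReL: "Re (char L t) = (LINT x|M. V x * cos (t * Y x)) / c"
        unfolding char_def by (subst integral_Re[symmetric]) (auto simp: L.integrable_iexp int Re_exp Im_exp simp del: integral_Re integral_Im)
      have ReL': "Re (char L' t) = (LINT x|N. V' x * cos (t * Y' x)) / c"
        unfolding char_def by (subst integral_Re[symmetric]) (auto simp: L'.integrable_iexp int' Re_exp Im_exp simp del: integral_Re integral_Im)
      have ImL: "Im (char L t) = (LINT x|M. V x * sin (t * Y x)) / c"
        unfolding char_def by (subst integral_Im[symmetric]) (auto simp: L.integrable_iexp int Re_exp Im_exp simp del: integral_Re integral_Im)
      have ImL': "Im (char L' t) = (LINT x|N. V' x * sin (t * Y' x)) / c"
        unfolding char_def by (subst integral_Im[symmetric]) (auto simp: L'.integrable_iexp int' Re_exp Im_exp simp del: integral_Re integral_Im)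
      show "char L t = char L' t"
        by (simp add: complex_eq_iff ReL ReL' ImL ImL' cV sV)
    qed
    then have "L = L'" using Levy_uniqueness rL rL' by blast
    then have "(LINT y|L. indicator A y) = (LINT y|L'. indicator A y :: real)" by simp
    then show ?thesis using A c1 by (subst (asm) int, simp, subst (asm) int', simp) simp
  qed
  have iM: "integrable M g" if "g \<in> borel_measurable M" "\<And>x. \<bar>g x\<bar> \<le> 1" for g :: "'a \<Rightarrow> real"
    using that by (intro M.integrable_const_bound[where B=1]) auto
  have iN: "integrable N g" if "g \<in> borel_measurable N" "\<And>x. \<bar>g x\<bar> \<le> 1" for g :: "'b \<Rightarrow> real"
    using that by (intro N.integrable_const_bound[where B=1]) auto
  have ab: "\<bar>u * v\<bar> \<le> 1" if "\<bar>u\<bar> \<le> 1" "\<bar>v\<bar> \<le> 1" for u v :: real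
    using mult_mono[OF that] by (simp add: abs_mult)
  have ind: "\<bar>indicator A y\<bar> \<le> (1::real)" for y :: real by (auto simp: indicator_def)
  have iM2: "integrable M (\<lambda>x. W x * g (Y x))" "integrable M (\<lambda>x. g (Y x))"
    if "g \<in> borel_measurable borel" "\<And>x. \<bar>g x\<bar> \<le> 1" for g :: "real \<Rightarrow> real"
    using that W by (auto intro!: iM ab)
  have iN2: "integrable N (\<lambda>x. W' x * g (Y' x))" "integrable N (\<lambda>x. g (Y' x))"
    if "g \<in> borel_measurable borel" "\<And>x. \<bar>g x\<bar> \<le> 1" for g :: "real \<Rightarrow> real"
    using that W' by (auto intro!: iN ab)
  have eM: "(LINT x|M. (2 + W x) * g (Y x)) = 2 * (LINT x|M. g (Y x)) + (LINT x|M. W x * g (Y x))"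
    if "g \<in> borel_measurable borel" "\<And>x. \<bar>g x\<bar> \<le> 1" for g :: "real \<Rightarrow> real"
    using iM2[OF that] by (simp add: distrib_right)
  have eN: "(LINT x|N. (2 + W' x) * g (Y' x)) = 2 * (LINT x|N. g (Y' x)) + (LINT x|N. W' x * g (Y' x))"
    if "g \<in> borel_measurable borel" "\<And>x. \<bar>g x\<bar> \<le> 1" for g :: "real \<Rightarrow> real"
    using iN2[OF that] by (simp add: distrib_right)
  have "(LINT x|M. 2 * indicator A (Y x)) = (LINT x|N. 2 * indicator A (Y' x) :: real)"
    by (rule key) (auto simp: c1 s1)
  moreover have "(LINT x|M. (2 + W x) * indicator A (Y x)) = (LINT x|N. (2 + W' x) * indicator A (Y' x))"
  proof (rule key)
    show "1 \<le> 2 + W x" "2 + W x \<le> 3" for x using W[of x] by auto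
    show "1 \<le> 2 + W' x" "2 + W' x \<le> 3" for x using W'[of x] by auto
    show "(LINT x|M. (2 + W x) * cos (s * Y x)) = (LINT x|N. (2 + W' x) * cos (s * Y' x))" for s
      by (subst eM[of "\<lambda>y. cos (s * y)"], simp, simp, subst eN[of "\<lambda>y. cos (s * y)"]) (auto simp: c1 cW)
    show "(LINT x|M. (2 + W x) * sin (s * Y x)) = (LINT x|N. (2 + W' x) * sin (s * Y' x))" for s
      by (subst eM[of "\<lambda>y. sin (s * y)"], simp, simp, subst eN[of "\<lambda>y. sin (s * y)"]) (auto simp: s1 sW)
  qed simp_all
  ultimately show ?thesis
    using A eM[of "indicator A"] eN[of "indicator A"] by (simp add: ind)
qed

text \<open>The free phase $\theta$ lets cosines alone carry the whole characteristic function. The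
  coordinates are treated one at a time: for a growing set $J$ of coordinates the events $Y_j \in A_j$
  replace the corresponding summands in the cosine. One step of this induction fixes all other
  factors as a bounded weight and applies
  \<open>borel_events_determined_by_weighted_characteristic\<close>.\<close>

lemma joint_law_determined_by_cosines:
  fixes Y :: "'i \<Rightarrow> 'a \<Rightarrow> real" and Y' :: "'i \<Rightarrow> 'b \<Rightarrow> real"
  assumes M: "prob_space M" and N: "prob_space N" and "finite I"
    and Y: "\<And>i. i \<in> I \<Longrightarrow> Y i \<in> borel_measurable M"
    and Y': "\<And>i. i \<in> I \<Longrightarrow> Y' i \<in> borel_measurable N"
    and eq: "\<And>s \<theta>. (LINT x|M. cos (\<theta> + (\<Sum>i\<in>I. s i * Y i x))) = (LINT x|N. cos (\<theta> + (\<Sum>i\<in>I. s i * Y' i x)))"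
  shows "distr M (Pi\<^sub>M I (\<lambda>_. borel)) (\<lambda>x. \<lambda>i\<in>I. Y i x) = distr N (Pi\<^sub>M I (\<lambda>_. borel)) (\<lambda>x. \<lambda>i\<in>I. Y' i x)"
proof -
  interpret M: prob_space M by fact
  interpret N: prob_space N by fact
  have pm: "\<bar>(\<Prod>j\<in>J. indicator (A j) (f j)) * cos t\<bar> \<le> (1::real)" for J A t and f :: "'i \<Rightarrow> real"
  proof -
    have "(\<Prod>j\<in>J. indicator (A j) (f j)) \<le> (1::real)" "0 \<le> (\<Prod>j\<in>J. indicator (A j) (f j) :: real)"
      by (auto intro!: prod_le_1 prod_nonneg simp: indicator_def)
    then show ?thesis using mult_mono[of "(\<Prod>j\<in>J. indicator (A j) (f j))" 1 "\<bar>cos t\<bar>" 1]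
      by (simp add: abs_mult)
  qed
  have main: "(LINT x|M. (\<Prod>j\<in>J. indicator (A j) (Y j x)) * cos (\<theta> + (\<Sum>i\<in>I-J. s i * Y i x))) =
      (LINT x|N. (\<Prod>j\<in>J. indicator (A j) (Y' j x)) * cos (\<theta> + (\<Sum>i\<in>I-J. s i * Y' i x)))"
    if J: "J \<subseteq> I" and A: "\<And>j. j \<in> J \<Longrightarrow> A j \<in> sets borel" for J A s \<theta>
    using finite_subset[OF J \<open>finite I\<close>] J A
  proof (induction J arbitrary: s \<theta>)
    case empty
    then show ?case using eq by simp
  next
    case (insert k J)
    have k: "k \<in> I" "k \<notin> J" and I: "I - J = insert k (I - insert k J)" using insert by auto
    define P where "P x = (\<Prod>j\<in>J. indicator (A j) (Y j x) :: real)" for x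
    define P' where "P' x = (\<Prod>j\<in>J. indicator (A j) (Y' j x) :: real)" for x
    define S where "S x = (\<Sum>i\<in>I - insert k J. s i * Y i x)" for x
    define S' where "S' x = (\<Sum>i\<in>I - insert k J. s i * Y' i x)" for x
    have [measurable]: "P \<in> borel_measurable M"
      unfolding P_def using insert.prems Y
      by (intro borel_measurable_prod) (auto intro!: measurable_compose[OF _ borel_measurable_indicator])
    have [measurable]: "P' \<in> borel_measurable N"
      unfolding P'_def using insert.prems Y'
      by (intro borel_measurable_prod) (auto intro!: measurable_compose[OF _ borel_measurable_indicator])
    have [measurable]: "S \<in> borel_measurable M" "S' \<in> borel_measurable N"
      unfolding S_def S'_def using Y Y' by (auto intro!: borel_measurable_sum)
    have [measurable]: "Y k \<in> borel_measurable M" "Y' k \<in> borel_measurable N" using Y Y' k by auto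
    have Pb: "\<bar>P x * cos u\<bar> \<le> 1" for x u by (simp only: P_def pm)
    have P'b: "\<bar>P' x * cos u\<bar> \<le> 1" for x u by (simp only: P'_def pm)
    have IH: "(LINT x|M. P x * cos (\<theta> + (t * Y k x + S x))) = (LINT x|N. P' x * cos (\<theta> + (t * Y' k x + S' x)))"
      for t \<theta>
    proof -
      have "(\<Sum>i\<in>I-J. (s(k := t)) i * Y i x) = t * Y k x + S x" for x
        unfolding I using \<open>finite I\<close> by (subst sum.insert) (auto simp: S_def intro!: sum.cong)
      moreover have "(\<Sum>i\<in>I-J. (s(k := t)) i * Y' i x) = t * Y' k x + S' x" for x
        unfolding I using \<open>finite I\<close> by (subst sum.insert) (auto simp: S'_def intro!: sum.cong)
      ultimately show ?thesis
        using insert.IH[of \<theta> "s(k := t)"] insert.prems by (simp add: P_def P'_def)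
    qed
    have iM: "integrable M (\<lambda>x. P x * cos (g x))" if "g \<in> borel_measurable M" for g
      using that by (intro M.integrable_const_bound[where B=1]) (auto simp: Pb)
    have iN: "integrable N (\<lambda>x. P' x * cos (g x))" if "g \<in> borel_measurable N" for g
      using that by (intro N.integrable_const_bound[where B=1]) (auto simp: P'b)
    \<comment> \<open>The product of two cosines is a combination of cosines, to which the induction hypothesis applies.\<close>
    have cc: "(LINT x|M. P x * cos (\<theta> + S x) * cos (\<alpha> + t * Y k x)) = (LINT x|N. P' x * cos (\<theta> + S' x) * cos (\<alpha> + t * Y' k x))" for t \<alpha>
    proof -
      have 1: "P x * cos (\<theta> + S x) * cos (\<alpha> + t * Y k x) =
        (P x * cos ((\<theta> + \<alpha>) + (t * Y k x + S x)) + P x * cos ((\<theta> - \<alpha>) + (- t * Y k x + S x))) / 2" for x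
        by (simp add: cos_times_cos algebra_simps)
      have 2: "P' x * cos (\<theta> + S' x) * cos (\<alpha> + t * Y' k x) =
        (P' x * cos ((\<theta> + \<alpha>) + (t * Y' k x + S' x)) + P' x * cos ((\<theta> - \<alpha>) + (- t * Y' k x + S' x))) / 2" for x
        by (simp add: cos_times_cos algebra_simps)
      show ?thesis unfolding 1 2
        using IH[of "\<theta> + \<alpha>" t] IH[of "\<theta> - \<alpha>" "- t"] by (simp add: iM iN)
    qed
    have c1: "(LINT x|M. cos (\<alpha> + t * Y k x)) = (LINT x|N. cos (\<alpha> + t * Y' k x))" for t \<alpha>
    proof -
      have "(\<Sum>i\<in>I. ((\<lambda>i. 0)(k := t)) i * Y i x) = t * Y k x" for x
        using sum.delta[OF \<open>finite I\<close>, of k "\<lambda>i. t * Y i x"] k by (simp add: if_distrib[of "\<lambda>c. c * _"] fun_upd_def cong: if_cong)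
      moreover have "(\<Sum>i\<in>I. ((\<lambda>i. 0)(k := t)) i * Y' i x) = t * Y' k x" for x
        using sum.delta[OF \<open>finite I\<close>, of k "\<lambda>i. t * Y' i x"] k by (simp add: if_distrib[of "\<lambda>c. c * _"] fun_upd_def cong: if_cong)
      ultimately show ?thesis using eq[of \<alpha> "(\<lambda>i. 0)(k := t)"] by simp
    qed
    \<comment> \<open>Sines are cosines with another phase.\<close>
    have sc: "sin y = cos (- (pi / 2) + y)" for y :: real
      by (simp add: cos_diff)
    have "(LINT x|M. (P x * cos (\<theta> + S x)) * indicator (A k) (Y k x)) =
      (LINT x|N. (P' x * cos (\<theta> + S' x)) * indicator (A k) (Y' k x))"
    proof (rule borel_events_determined_by_weighted_characteristic[OF M N])
      show "(LINT x|M. sin (s * Y k x)) = (LINT x|N. sin (s * Y' k x))" for s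
        unfolding sc by (rule c1)
      show "(LINT x|M. cos (s * Y k x)) = (LINT x|N. cos (s * Y' k x))" for s
        using c1[of 0 s] by simp
      show "(LINT x|M. P x * cos (\<theta> + S x) * sin (s * Y k x)) = (LINT x|N. P' x * cos (\<theta> + S' x) * sin (s * Y' k x))" for s
        unfolding sc by (rule cc)
      show "(LINT x|M. P x * cos (\<theta> + S x) * cos (s * Y k x)) = (LINT x|N. P' x * cos (\<theta> + S' x) * cos (s * Y' k x))" for s
        using cc[of 0 s] by simp
    qed (use insert.prems in \<open>auto simp: Pb P'b\<close>)
    then show ?case
      using insert.hyps by (simp add: P_def P'_def S_def S'_def mult_ac)
  qed
  let ?B = "\<lambda>_. borel :: real measure"
  have mY[measurable]: "(\<lambda>x. \<lambda>i\<in>I. Y i x) \<in> measurable M (Pi\<^sub>M I ?B)"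
    using Y by (intro measurable_restrict) auto
  have mY'[measurable]: "(\<lambda>x. \<lambda>i\<in>I. Y' i x) \<in> measurable N (Pi\<^sub>M I ?B)"
    using Y' by (intro measurable_restrict) auto
  show ?thesis
  proof (rule measure_eqI_PiM_finite[OF \<open>finite I\<close>])
    fix A :: "'i \<Rightarrow> real set" assume A: "\<And>i. i \<in> I \<Longrightarrow> A i \<in> sets borel"
    have A': "Pi\<^sub>E I A \<in> sets (Pi\<^sub>M I ?B)" using A \<open>finite I\<close> by (intro sets_PiM_I_finite) auto
    have ind: "(\<Prod>j\<in>I. indicator (A j) (f j)) = (indicator (Pi\<^sub>E I A) (\<lambda>i\<in>I. f i) :: real)" for f
      using \<open>finite I\<close> by (auto simp: indicator_def PiE_iff prod_zero_iff)
    have "(LINT x|M. indicator (Pi\<^sub>E I A) (\<lambda>i\<in>I. Y i x)) = (LINT x|N. indicator (Pi\<^sub>E I A) (\<lambda>i\<in>I. Y' i x) :: real)"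
      using main[of I A 0] A by (simp add: ind)
    then have "(LINT z|distr M (Pi\<^sub>M I ?B) (\<lambda>x. \<lambda>i\<in>I. Y i x). indicator (Pi\<^sub>E I A) z) =
      (LINT z|distr N (Pi\<^sub>M I ?B) (\<lambda>x. \<lambda>i\<in>I. Y' i x). indicator (Pi\<^sub>E I A) z :: real)"
      using A' by (subst (1 2) integral_distr) auto
    then have "measure (distr M (Pi\<^sub>M I ?B) (\<lambda>x. \<lambda>i\<in>I. Y i x)) (Pi\<^sub>E I A) =
      measure (distr N (Pi\<^sub>M I ?B) (\<lambda>x. \<lambda>i\<in>I. Y' i x)) (Pi\<^sub>E I A)"
      using sets.sets_into_space[OF A'] by (simp add: Int_absorb2)
    then show "emeasure (distr M (Pi\<^sub>M I ?B) (\<lambda>x. \<lambda>i\<in>I. Y i x)) (Pi\<^sub>E I A) =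
      emeasure (distr N (Pi\<^sub>M I ?B) (\<lambda>x. \<lambda>i\<in>I. Y' i x)) (Pi\<^sub>E I A)"
      by (simp add: finite_measure.emeasure_eq_measure M.finite_measure_distr N.finite_measure_distr mY mY')
  next
    show "range (\<lambda>_ :: nat. Pi\<^sub>E I (\<lambda>_. UNIV)) \<subseteq> prod_algebra I ?B"
      using \<open>finite I\<close> by (auto intro!: prod_algebraI_finite)
    show "(\<Union>i::nat. Pi\<^sub>E I (\<lambda>_. UNIV)) = space (Pi\<^sub>M I ?B)" by (simp add: space_PiM)
    show "emeasure (distr M (Pi\<^sub>M I ?B) (\<lambda>x. \<lambda>i\<in>I. Y i x)) (Pi\<^sub>E I (\<lambda>_. UNIV)) \<noteq> \<infinity>" for i :: nat
      by (simp add: finite_measure.emeasure_eq_measure M.finite_measure_distr mY)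
  qed simp_all
qed

section \<open>Differentiation along lines and one-dimensional Gaussian integration by parts\<close>

lemma has_real_derivative_partial_deriv:
  assumes "\<And>x. (\<lambda>t. f (x(i := t))) differentiable (at (x i))"
  shows "((\<lambda>t. f (x(i := t))) has_real_derivative partial_deriv i f (x(i := s))) (at s)"
  using assms[of "x(i := s)"] by (simp add: partial_deriv_def flip: DERIV_deriv_iff_real_differentiable)

text \<open>The chain rule for a function whose partial derivatives exist and are continuous. The coordinates
  are set in motion one after the other: moving one more coordinate is a function of two variables
  on the diagonal, with a derivative in the old variable by induction and a jointly continuous
  partial derivative in the new one.\<close>

lemma has_real_derivative_along_line:
  fixes f :: "(nat \<Rightarrow> real) \<Rightarrow> real"
  assumes dep: "depends_on_first n f"
    and cont: "\<And>i. i < n \<Longrightarrow> continuous_on UNIV (partial_deriv i f)"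
    and diff: "\<And>i x. i < n \<Longrightarrow> (\<lambda>t. f (x(i := t))) differentiable (at (x i))"
  shows "((\<lambda>t. f (\<lambda>i. x i + t * a i)) has_real_derivative
    (\<Sum>i<n. a i * partial_deriv i f (\<lambda>i. x i + t * a i))) (at t)"
proof -
  define y where "y k x t = (\<lambda>i::nat. if i < k then x i + t * a i else x i)" for k x t
  have "((\<lambda>t. f (y k x t)) has_real_derivative (\<Sum>i<k. a i * partial_deriv i f (y k x t))) (at t)"
    if "k \<le> n" for k x t
    using that
  proof (induction k arbitrary: x t)
    case 0
    then show ?case by (simp add: y_def)
  next
    case (Suc k)
    then have k: "k < n" by simp
    \<comment> \<open>The first k coordinates move with time s and coordinate k with time r.\<close>
    define p where "p s r = y k (x(k := x k + r * a k)) s" for s r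
    have pk: "p s r = (y k x s)(k := x k + r * a k)" for s r
      by (auto simp: p_def y_def)
    have pSuc: "p s s = y (Suc k) x s" for s
      by (auto simp: p_def y_def less_Suc_eq)
    have cp: "continuous_on UNIV (\<lambda>(s, r). p s r)"
    proof (rule continuous_on_coordinatewise_then_product)
      show "continuous_on UNIV (\<lambda>z. (case z of (s, r) \<Rightarrow> p s r) i)" for i
        by (cases "i < k"; cases "i = k")
          (auto simp: p_def y_def case_prod_beta intro!: continuous_intros)
    qed
    have d1: "((\<lambda>s. f (p s t)) has_derivative (\<lambda>h. (\<Sum>i<k. a i * partial_deriv i f (p t t)) * h)) (at t within UNIV)"
      unfolding p_def using k by (intro Suc.IH[unfolded has_field_derivative_def]) simp
    define fy where "fy s r = (a k * partial_deriv k f (p s r)) *\<^sub>R (id_blinfun :: real \<Rightarrow>\<^sub>L real)" for s r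
    have d2: "((\<lambda>r. f (p s r)) has_derivative blinfun_apply (fy s r)) (at r within UNIV)" for s r
    proof -
      have "((\<lambda>t. f ((y k x s)(k := t))) has_real_derivative partial_deriv k f (p s r)) (at (x k + r * a k))"
        unfolding pk by (rule has_real_derivative_partial_deriv) (use diff k in auto)
      moreover have "((\<lambda>r. x k + r * a k) has_real_derivative a k) (at r)"
        by (auto intro!: derivative_eq_intros)
      ultimately have "((\<lambda>r. f (p s r)) has_real_derivative partial_deriv k f (p s r) * a k) (at r)"
        unfolding pk by (rule DERIV_chain2)
      moreover have "blinfun_apply (fy s r) = (*) (partial_deriv k f (p s r) * a k)"
        by (rule ext) (simp add: fy_def blinfun.scaleR_left)
      ultimately show ?thesis
        by (simp add: has_field_derivative_def)
    qed
    have d3: "continuous (at (t, t) within UNIV \<times> UNIV) (\<lambda>(s, r). fy s r)"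
    proof -
      have "continuous_on UNIV (\<lambda>z. partial_deriv k f (case z of (s, r) \<Rightarrow> p s r))"
        using continuous_on_compose2[OF cont[OF k] cp] by simp
      then have "continuous_on UNIV (\<lambda>z. fy (fst z) (snd z))"
        unfolding fy_def by (auto simp: case_prod_beta intro!: continuous_intros)
      then show ?thesis
        by (simp add: case_prod_beta' continuous_on_eq_continuous_at)
    qed
    have h1: "((\<lambda>(s, r). f (p s r)) has_derivative
      (\<lambda>(hs, hr). (\<Sum>i<k. a i * partial_deriv i f (p t t)) * hs + fy t t hr)) (at (t, t))"
      using has_derivative_partialsI[OF d1 d2 d3] by simp
    have h2: "((\<lambda>s. (s, s)) has_derivative (\<lambda>h. (h, h))) (at t)"
      by (auto intro!: derivative_eq_intros)
    have "((\<lambda>s. f (p s s)) has_derivative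
      (\<lambda>h. (\<Sum>i<k. a i * partial_deriv i f (p t t)) * h + fy t t h)) (at t)"
      using has_derivative_compose[OF h2 h1] by simp
    moreover have "(\<lambda>h. (\<Sum>i<k. a i * partial_deriv i f (p t t)) * h + fy t t h) =
      (*) (\<Sum>i<Suc k. a i * partial_deriv i f (p t t))"
      by (rule ext) (simp add: fy_def blinfun.scaleR_left distrib_right)
    ultimately show ?case
      by (simp only: has_field_derivative_def pSuc)
  qed
  from this[of n x t] have 1: "((\<lambda>t. f (y n x t)) has_real_derivative (\<Sum>i<n. a i * partial_deriv i f (y n x t))) (at t)"
    by simp
  have f: "f (y n x t) = f (\<lambda>i. x i + t * a i)" for t
    using dep by (auto simp: depends_on_first_def y_def)
  have "partial_deriv i f (y n x t) = partial_deriv i f (\<lambda>i. x i + t * a i)" if "i < n" for i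
  proof -
    have "f ((y n x t)(i := s)) = f ((\<lambda>i. x i + t * a i)(i := s))" for s
      using dep by (auto simp: depends_on_first_def y_def)
    then show ?thesis using that by (simp add: partial_deriv_def y_def)
  qed
  with 1 show ?thesis by (simp add: f)
qed

text \<open>Compare $1 + \sum_i x_i$ with $n + 1$ times its largest summand. This reduces polynomial growth in
  several variables to moments of single variables.\<close>

lemma power_one_plus_sum_le:
  fixes x :: "nat \<Rightarrow> real"
  assumes "\<And>i. 0 \<le> x i"
  shows "(1 + (\<Sum>i<n. x i)) ^ m \<le> real (Suc n) ^ m * (1 + (\<Sum>i<n. x i ^ m))"
proof -
  define z where "z = Max (insert 1 (x ` {..<n}))"
  have z: "1 \<le> z" "\<And>i. i < n \<Longrightarrow> x i \<le> z" unfolding z_def by (auto intro: Max_ge)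
  have "z \<in> insert 1 (x ` {..<n})" unfolding z_def by (rule Max_in) auto
  then have "z ^ m \<le> 1 + (\<Sum>i<n. x i ^ m)"
  proof
    assume "z = 1" then show ?thesis using assms by (simp add: sum_nonneg)
  next
    assume "z \<in> x ` {..<n}"
    then obtain i where "i < n" "z = x i" by auto
    then have "z ^ m \<le> (\<Sum>i<n. x i ^ m)"
      using assms by (auto intro!: member_le_sum[of i "{..<n}" "\<lambda>i. x i ^ m"])
    then show ?thesis by simp
  qed
  moreover have "1 + (\<Sum>i<n. x i) \<le> real (Suc n) * z"
    using sum_bounded_above[of "{..<n}" x z] z by (auto simp: algebra_simps)
  then have "(1 + (\<Sum>i<n. x i)) ^ m \<le> (real (Suc n) * z) ^ m"
    using assms by (intro power_mono) (auto simp: sum_nonneg add_nonneg_nonneg)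
  ultimately show ?thesis
    by (smt (verit) mult_left_mono of_nat_0_le_iff power_mult_distrib zero_le_power)
qed

lemma integrable_std_normal_polynomial_growth:
  fixes g :: "real \<Rightarrow> real"
  assumes [measurable]: "g \<in> borel_measurable borel" and g: "\<And>t. \<bar>g t\<bar> \<le> A * (1 + \<bar>t\<bar>) ^ m"
  shows "integrable std_normal_distribution g"
proof -
  have i: "integrable std_normal_distribution (\<lambda>t. \<bar>t\<bar> ^ m)" for m
    using integrable_std_normal_moment_abs[of m] by (subst integrable_density) auto
  have "\<bar>g t\<bar> \<le> \<bar>A\<bar> * (2 ^ m * (1 + \<bar>t\<bar> ^ m))" for t
  proof -
    have "(1 + \<bar>t\<bar>) ^ m \<le> 2 ^ m * (1 + \<bar>t\<bar> ^ m)"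
      using power_one_plus_sum_le[of "\<lambda>_. \<bar>t\<bar>" 1 m] by simp
    then have "\<bar>A\<bar> * (1 + \<bar>t\<bar>) ^ m \<le> \<bar>A\<bar> * (2 ^ m * (1 + \<bar>t\<bar> ^ m))" by (intro mult_left_mono) auto
    moreover have "A * (1 + \<bar>t\<bar>) ^ m \<le> \<bar>A\<bar> * (1 + \<bar>t\<bar>) ^ m" by (intro mult_right_mono) auto
    ultimately show ?thesis using g[of t] by linarith
  qed
  moreover have "integrable std_normal_distribution (\<lambda>t. \<bar>A\<bar> * (2 ^ m * (1 + \<bar>t\<bar> ^ m)))"
    using i[of m] i[of 0] by simp
  ultimately show ?thesis
    by (intro Bochner_Integration.integrable_bound[of std_normal_distribution "\<lambda>t. \<bar>A\<bar> * (2 ^ m * (1 + \<bar>t\<bar> ^ m))" g])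
      (auto intro!: AE_I2 order_trans[OF _ abs_ge_self])
qed

text \<open>The standard normal density $\gamma$ satisfies $\gamma'(t) = - t \gamma(t)$, so the difference of
  the two integrands is the derivative of $\gamma g$, which vanishes at both ends of the line.\<close>

lemma std_normal_integration_by_parts:
  fixes g g' :: "real \<Rightarrow> real"
  assumes g': "\<And>t. (g has_real_derivative g' t) (at t)"
    and cont: "continuous_on UNIV g'"
    and bg: "\<And>t. \<bar>g t\<bar> \<le> A * (1 + \<bar>t\<bar>) ^ m" and bg': "\<And>t. \<bar>g' t\<bar> \<le> B * (1 + \<bar>t\<bar>) ^ l"
  shows "(LINT t|std_normal_distribution. t * g t) = (LINT t|std_normal_distribution. g' t)"
proof -
  let ?d = "std_normal_density"
  have cg: "continuous_on UNIV g" using g' by (meson DERIV_isCont continuous_at_imp_continuous_on)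
  have [measurable]: "g \<in> borel_measurable borel" "g' \<in> borel_measurable borel"
    using cg cont by (auto intro: borel_measurable_continuous_onI)
  have b2: "\<bar>t * g t\<bar> \<le> A * (1 + \<bar>t\<bar>) ^ Suc m" for t
  proof -
    have "\<bar>t * g t\<bar> \<le> (1 + \<bar>t\<bar>) * (A * (1 + \<bar>t\<bar>) ^ m)"
      unfolding abs_mult using bg[of t] by (intro mult_mono) auto
    then show ?thesis by (simp add: mult_ac)
  qed
  have i1: "integrable std_normal_distribution g'" "integrable std_normal_distribution (\<lambda>t. t * g t)"
    by (rule integrable_std_normal_polynomial_growth[OF _ bg'], simp)
      (rule integrable_std_normal_polynomial_growth[OF _ b2], simp)
  have i2: "integrable lborel (\<lambda>t. ?d t * g' t)" "integrable lborel (\<lambda>t. ?d t * (t * g t))"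
    using i1 by (auto simp: integrable_density)
  define F where "F t = ?d t * g t" for t
  define F' where "F' t = ?d t * g' t - ?d t * (t * g t)" for t
  have "((\<lambda>t. c * exp (- t\<^sup>2 / 2)) has_real_derivative - t * (c * exp (- t\<^sup>2 / 2))) (at t)" for c t :: real
    by (auto intro!: derivative_eq_intros)
  then have dd: "(?d has_real_derivative - t * ?d t) (at t)" for t
    unfolding std_normal_density_def .
  have dF: "(F has_real_derivative F' t) (at t)" for t
    unfolding F_def F'_def by (auto intro!: derivative_eq_intros dd g' simp: algebra_simps)
  have cd: "continuous_on UNIV ?d" using dd by (meson DERIV_isCont continuous_at_imp_continuous_on)
  have cF': "isCont F' t" for t
    using cg cont cd unfolding F'_def
    by (auto simp: continuous_on_eq_continuous_at intro!: continuous_intros)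
  \<comment> \<open>The constant comes from completing the square: t^2 / 2 + 3 / 2 >= 1 + |t|.\<close>
  have bF: "\<bar>F t\<bar> \<le> (A * exp (3 / 2)) * ((1 + \<bar>t\<bar>) ^ m / exp (1 + \<bar>t\<bar>))" for t
  proof -
    have A: "0 \<le> A" using bg[of 0] by simp
    have "- t\<^sup>2 / 2 \<le> 3 / 2 - (1 + \<bar>t\<bar>)"
      using zero_le_power2[of "\<bar>t\<bar> - 1"] by (simp add: power2_eq_square algebra_simps)
    then have "exp (- t\<^sup>2 / 2) \<le> exp (3 / 2) / exp (1 + \<bar>t\<bar>)" by (simp flip: exp_diff)
    moreover have "1 / sqrt (2 * pi) \<le> 1" using pi_gt3 by (simp add: real_le_rsqrt)
    ultimately have "?d t \<le> 1 * (exp (3 / 2) / exp (1 + \<bar>t\<bar>))"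
      unfolding std_normal_density_def by (intro mult_mono) auto
    then have "?d t * \<bar>g t\<bar> \<le> (exp (3 / 2) / exp (1 + \<bar>t\<bar>)) * (A * (1 + \<bar>t\<bar>) ^ m)"
      using bg[of t] by (intro mult_mono) auto
    then show ?thesis by (simp add: F_def abs_mult mult_ac)
  qed
  have lim: "(F \<longlongrightarrow> 0) S" if "filterlim (\<lambda>t::real. 1 + \<bar>t\<bar>) at_top S" for S
  proof -
    have "((\<lambda>t. (A * exp (3 / 2)) * ((1 + \<bar>t\<bar>) ^ m / exp (1 + \<bar>t\<bar>))) \<longlongrightarrow> (A * exp (3 / 2)) * 0) S"
      by (intro tendsto_mult_left filterlim_compose[OF tendsto_power_div_exp_0 that])
    then have "((\<lambda>t. (A * exp (3 / 2)) * ((1 + \<bar>t\<bar>) ^ m / exp (1 + \<bar>t\<bar>))) \<longlongrightarrow> 0) S" by simp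
    then show ?thesis
      by (rule Lim_null_comparison[rotated]) (simp only: real_norm_def bF eventually_True)
  qed
  have "filterlim (\<lambda>t::real. 1 + \<bar>t\<bar>) at_top at_top"
    by (rule filterlim_at_top_mono[OF filterlim_ident]) (intro always_eventually allI, linarith)
  moreover have "filterlim (\<lambda>t::real. 1 + \<bar>t\<bar>) at_top at_bot"
    using \<open>filterlim (\<lambda>t::real. 1 + \<bar>t\<bar>) at_top at_top\<close> by (simp add: filterlim_at_bot_mirror)
  ultimately have "(LBINT t=-\<infinity>..\<infinity>. F' t) = 0 - 0"
    using lim
  proof (intro interval_integral_FTC_integrable[where F=F])
    show "(F has_vector_derivative F' t) (at t)" for t
      using dF by (simp add: has_real_derivative_iff_has_vector_derivative)
    have "integrable lborel F'" unfolding F'_def using i2 by (rule Bochner_Integration.integrable_diff)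
    then show "set_integrable lborel (einterval (- \<infinity>) \<infinity>) F'"
      by (simp add: set_integrable_def)
  qed (use cF' in \<open>auto simp: ereal_tendsto_simps1\<close>)
  then have "(LINT t|lborel. F' t) = 0"
    by (simp add: interval_lebesgue_integral_def set_lebesgue_integral_def)
  then show ?thesis
    using i2 by (simp add: F'_def integral_density)
qed

section \<open>Isonormal Gaussian processes\<close>

lemma std_normal_cos: "(LINT t|std_normal_distribution. cos (\<theta> + t * c)) = cos \<theta> * exp (- c\<^sup>2 / 2)"
proof -
  interpret real_distribution std_normal_distribution by (rule real_dist_normal_dist)
  have i: "integrable std_normal_distribution (\<lambda>t. iexp (c * t))" by (rule integrable_iexp) simp_all
  have "(LINT t|std_normal_distribution. Re (iexp (c * t))) = Re (char std_normal_distribution c)"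
    unfolding char_def by (rule integral_Re[OF i])
  then have cos: "(LINT t|std_normal_distribution. cos (c * t)) = exp (- c\<^sup>2 / 2)"
    by (simp add: char_std_normal_distribution Re_exp)
  have "(LINT t|std_normal_distribution. Im (iexp (c * t))) = Im (char std_normal_distribution c)"
    unfolding char_def by (rule integral_Im[OF i])
  then have sin: "(LINT t|std_normal_distribution. sin (c * t)) = 0"
    by (simp add: char_std_normal_distribution Im_exp)
  have ic: "integrable std_normal_distribution (\<lambda>t. cos (c * t))"
    by (rule integrable_const_bound[where B=1]) auto
  have isin: "integrable std_normal_distribution (\<lambda>t. sin (c * t))"
    by (rule integrable_const_bound[where B=1]) auto
  have "(LINT t|std_normal_distribution. cos (\<theta> + t * c)) =
    (LINT t|std_normal_distribution. cos \<theta> * cos (c * t) - sin \<theta> * sin (c * t))"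
    by (simp add: cos_add mult.commute)
  also have "\<dots> = cos \<theta> * exp (- c\<^sup>2 / 2)"
    using ic isin by (simp add: cos sin)
  finally show ?thesis .
qed

locale isonormal = prob_space M for M :: "'w measure" +
  fixes X :: "'h::real_inner \<Rightarrow> 'w \<Rightarrow> real"
  assumes isonormal: "isonormal_gaussian_process M X"
begin

lemma X_measurable[measurable]: "X v \<in> borel_measurable M"
  using isonormal by (auto simp: isonormal_gaussian_process_def)

lemma X_linear: "AE \<omega> in M. X (a *\<^sub>R v + b *\<^sub>R u) \<omega> = a * X v \<omega> + b * X u \<omega>"
  using isonormal by (auto simp: isonormal_gaussian_process_def)

lemma X_covariance: "expectation (\<lambda>\<omega>. X v \<omega> * X u \<omega>) = v \<bullet> u"
  using isonormal by (auto simp: isonormal_gaussian_process_def)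

lemma X_zero: "AE \<omega> in M. X 0 \<omega> = 0"
  using X_linear[of 0 0 0 0] by simp

lemma X_scale: "AE \<omega> in M. X (c *\<^sub>R v) \<omega> = c * X v \<omega>"
  using X_linear[of c v 0 0] by simp

lemma X_sum:
  assumes "finite I"
  shows "AE \<omega> in M. X (\<Sum>i\<in>I. c i *\<^sub>R v i) \<omega> = (\<Sum>i\<in>I. c i * X (v i) \<omega>)"
  using assms
proof induction
  case empty
  show ?case using X_zero by simp
next
  case (insert j I)
  have "AE \<omega> in M. X (c j *\<^sub>R v j + 1 *\<^sub>R (\<Sum>i\<in>I. c i *\<^sub>R v i)) \<omega> =
    c j * X (v j) \<omega> + 1 * X (\<Sum>i\<in>I. c i *\<^sub>R v i) \<omega>"
    by (rule X_linear)
  with insert.IH show ?case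
    by eventually_elim (use insert.hyps in simp)
qed

text \<open>The covariance fixes the variance, which rules out the degenerate alternative in the definition of
  a centred Gaussian variable.\<close>

lemma X_law:
  assumes "v \<noteq> 0"
  shows "distr M borel (\<lambda>\<omega>. X v \<omega> / norm v) = std_normal_distribution"
proof -
  have "centred_gaussian M (\<lambda>\<omega>. \<Sum>u\<in>{v}. 1 * X u \<omega>)"
    using isonormal unfolding isonormal_gaussian_process_def by (meson finite.emptyI finite.insertI)
  then have "centred_gaussian M (X v)" by simp
  then consider "AE \<omega> in M. X v \<omega> = 0" | \<sigma> where "0 < \<sigma>" "distributed M lborel (X v) (normal_density 0 \<sigma>)"
    by (auto simp: centred_gaussian_def)
  then show ?thesis
  proof cases
    case 1
    have "expectation (\<lambda>\<omega>. X v \<omega> * X v \<omega>) = expectation (\<lambda>\<omega>. 0)"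
      using 1 by (intro integral_cong_AE) auto
    then show ?thesis using X_covariance[of v v] assms by simp
  next
    case 2
    have "expectation (X v) = 0" using normal_distributed_expectation[OF 2] .
    then have "\<sigma>\<^sup>2 = expectation (\<lambda>\<omega>. X v \<omega> * X v \<omega>)"
      using normal_distributed_variance[OF 2] by (simp add: power2_eq_square)
    then have "\<sigma>\<^sup>2 = (norm v)\<^sup>2" by (simp add: X_covariance power2_norm_eq_inner)
    then have "\<sigma> = norm v" using 2(1) by (simp add: power2_eq_iff_nonneg)
    with 2 have "distributed M lborel (\<lambda>\<omega>. X v \<omega> / norm v) std_normal_density"
      using normal_standard_normal_convert[of "norm v" "X v" 0] by simp
    then have "distr M lborel (\<lambda>\<omega>. X v \<omega> / norm v) = std_normal_distribution"
      by (rule distributed_distr_eq_density)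
    then show ?thesis by (simp cong: distr_cong)
  qed
qed

lemma X_cos: "expectation (\<lambda>\<omega>. cos (\<theta> + X v \<omega>)) = cos \<theta> * exp (- (norm v)\<^sup>2 / 2)"
proof (cases "v = 0")
  case True
  have "expectation (\<lambda>\<omega>. cos (\<theta> + X v \<omega>)) = expectation (\<lambda>\<omega>. cos \<theta>)"
    using X_zero True by (intro integral_cong_AE) auto
  then show ?thesis using True by (simp add: prob_space)
next
  case False
  have "(LINT t|distr M borel (\<lambda>\<omega>. X v \<omega> / norm v). cos (\<theta> + t * norm v)) = expectation (\<lambda>\<omega>. cos (\<theta> + X v \<omega>))"
    using False by (subst integral_distr) auto
  then show ?thesis by (simp add: X_law[OF False] std_normal_cos)
qed

lemma X_moments: "integrable M (\<lambda>\<omega>. \<bar>X v \<omega>\<bar> ^ m)"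
proof (cases "v = 0")
  case True
  have "integrable M (\<lambda>\<omega>. \<bar>0::real\<bar> ^ m)" by simp
  then show ?thesis
    by (rule integrable_cong_AE_imp) (use X_zero True in auto)
next
  case False
  have "integrable std_normal_distribution (\<lambda>t. \<bar>t * norm v\<bar> ^ m)"
  proof (rule integrable_std_normal_polynomial_growth[where m=m])
    show "\<bar>\<bar>t * norm v\<bar> ^ m\<bar> \<le> norm v ^ m * (1 + \<bar>t\<bar>) ^ m" for t
      using mult_left_mono[OF power_mono[of "\<bar>t\<bar>" "1 + \<bar>t\<bar>" m], of "norm v ^ m"]
      by (simp add: abs_mult power_mult_distrib mult.commute)
  qed simp
  then have "integrable (distr M borel (\<lambda>\<omega>. X v \<omega> / norm v)) (\<lambda>t. \<bar>t * norm v\<bar> ^ m)"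
    by (simp add: X_law[OF False])
  then show ?thesis using False by (subst (asm) integrable_distr_eq) auto
qed

lemma continuous_of_process_measurable:
  assumes "continuous_on UNIV h"
  shows "(\<lambda>\<omega>. h (\<lambda>i::nat. X (v i) \<omega>) :: real) \<in> borel_measurable M"
proof -
  have "(\<lambda>\<omega>. (\<lambda>i::nat. X (v i) \<omega>)) \<in> borel_measurable M"
    by (rule measurable_coordinatewise_then_product) simp
  then show ?thesis
    using measurable_compose borel_measurable_continuous_onI[OF assms] by blast
qed

text \<open>All moments of the $X_v$ are finite, which settles integrability of every smooth functional and of
  its derivatives.\<close>

lemma polynomial_growth_integrable:
  assumes h: "continuous_on UNIV h" and g: "\<And>x. \<bar>h x\<bar> \<le> A * (1 + (\<Sum>i<n. \<bar>x i\<bar>)) ^ m"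
  shows "integrable M (\<lambda>\<omega>. h (\<lambda>i::nat. X (v i) \<omega>) :: real)"
proof -
  have [measurable]: "(\<lambda>\<omega>. h (\<lambda>i. X (v i) \<omega>)) \<in> borel_measurable M"
    by (rule continuous_of_process_measurable[OF h])
  define c where "c = \<bar>A\<bar> * real (Suc n) ^ m"
  have "\<bar>h x\<bar> \<le> c * (1 + (\<Sum>i<n. \<bar>x i\<bar> ^ m))" for x
  proof -
    have "A * (1 + (\<Sum>i<n. \<bar>x i\<bar>)) ^ m \<le> \<bar>A\<bar> * (1 + (\<Sum>i<n. \<bar>x i\<bar>)) ^ m"
      by (intro mult_right_mono) (auto intro!: zero_le_power add_nonneg_nonneg sum_nonneg)
    also have "\<dots> \<le> \<bar>A\<bar> * (real (Suc n) ^ m * (1 + (\<Sum>i<n. \<bar>x i\<bar> ^ m)))"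
      using power_one_plus_sum_le[of "\<lambda>i. \<bar>x i\<bar>" n m] by (intro mult_left_mono) auto
    finally show ?thesis using g[of x] by (simp add: c_def mult.assoc)
  qed
  note bound = this
  show ?thesis
  proof (rule Bochner_Integration.integrable_bound)
    show "integrable M (\<lambda>\<omega>. c * (1 + (\<Sum>i<n. \<bar>X (v i) \<omega>\<bar> ^ m)))" using X_moments by simp
    show "AE \<omega> in M. norm (h (\<lambda>i. X (v i) \<omega>)) \<le> norm (c * (1 + (\<Sum>i<n. \<bar>X (v i) \<omega>\<bar> ^ m)))"
      by (intro AE_I2) (unfold real_norm_def, rule order_trans[OF bound abs_ge_self])
  qed fact
qed

lemma polynomial_growth_square_integrable:
  assumes h: "continuous_on UNIV h" and g: "\<And>x. \<bar>h x\<bar> \<le> A * (1 + (\<Sum>i<n. \<bar>x i\<bar>)) ^ m"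
  shows "integrable M (\<lambda>\<omega>. (h (\<lambda>i::nat. X (v i) \<omega>))\<^sup>2 :: real)"
proof (rule polynomial_growth_integrable[where h="\<lambda>x. (h x)\<^sup>2"])
  show "continuous_on UNIV (\<lambda>x. (h x)\<^sup>2)" using h by (intro continuous_intros)
  show "\<bar>(h x)\<^sup>2\<bar> \<le> A\<^sup>2 * (1 + (\<Sum>i<n. \<bar>x i\<bar>)) ^ (m * 2)" for x
  proof -
    have "\<bar>h x\<bar>\<^sup>2 \<le> (A * (1 + (\<Sum>i<n. \<bar>x i\<bar>)) ^ m)\<^sup>2" by (rule power_mono[OF g]) simp
    then show ?thesis by (simp only: power_mult_distrib power_mult power2_abs abs_power2)
  qed
qed

lemma integrable_product_of_square_integrable:
  fixes f g :: "'w \<Rightarrow> real"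
  assumes [measurable]: "f \<in> borel_measurable M" "g \<in> borel_measurable M"
    and "integrable M (\<lambda>\<omega>. (f \<omega>)\<^sup>2)" "integrable M (\<lambda>\<omega>. (g \<omega>)\<^sup>2)"
  shows "integrable M (\<lambda>\<omega>. f \<omega> * g \<omega>)"
proof (rule Bochner_Integration.integrable_bound)
  show "integrable M (\<lambda>\<omega>. (f \<omega>)\<^sup>2 + (g \<omega>)\<^sup>2)" using assms by simp
  have "\<bar>a * b\<bar> \<le> a\<^sup>2 + b\<^sup>2" for a b :: real
    using sum_squares_bound[of "\<bar>a\<bar>" "\<bar>b\<bar>"] mult_nonneg_nonneg[OF abs_ge_zero[of a] abs_ge_zero[of b]]
    unfolding abs_mult power2_abs by linarith
  note bound = this
  show "AE \<omega> in M. norm (f \<omega> * g \<omega>) \<le> norm ((f \<omega>)\<^sup>2 + (g \<omega>)\<^sup>2)"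
    by (intro AE_I2) (unfold real_norm_def, rule order_trans[OF bound abs_ge_self])
qed simp

lemma X_square_integrable: "integrable M (\<lambda>\<omega>. (X v \<omega>)\<^sup>2)"
  using X_moments[of v 2] by simp

text \<open>The component of $v_i$ in the direction $w$ can be driven by an independent standard normal
  variable. Both sides are centred Gaussian: for $V = \sum_i s_i v_i$ the combination
  $\sum_i s_i X_{v_i}$ has variance $\|V\|^2$, and the decoupled one has variance
  $\|V - (V, w) w\|^2 + (V, w)^2$. These agree by Pythagoras, hence so do the characteristic
  functions.\<close>

lemma law_decoupled_along_unit_vector:
  fixes v :: "'i \<Rightarrow> 'h"
  assumes "norm w = 1" "finite I"
  shows "distr M (Pi\<^sub>M I (\<lambda>_. borel)) (\<lambda>\<omega>. \<lambda>i\<in>I. X (v i) \<omega>) =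
    distr (M \<Otimes>\<^sub>M std_normal_distribution) (Pi\<^sub>M I (\<lambda>_. borel))
      (\<lambda>z. \<lambda>i\<in>I. X (v i - (v i \<bullet> w) *\<^sub>R w) (fst z) + snd z * (v i \<bullet> w))"
proof (rule joint_law_determined_by_cosines)
  interpret N: prob_space std_normal_distribution
    using real_dist_normal_dist by (simp add: real_distribution_def)
  interpret P: pair_prob_space M std_normal_distribution ..
  show "prob_space M" by (rule prob_space_axioms)
  show "prob_space (M \<Otimes>\<^sub>M std_normal_distribution)" by (rule P.prob_space_axioms)
  show "finite I" by fact
  fix s :: "'i \<Rightarrow> real" and \<theta> :: real
  define v' where "v' i = v i - (v i \<bullet> w) *\<^sub>R w" for i
  define V where "V = (\<Sum>i\<in>I. s i *\<^sub>R v i)"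
  define V' where "V' = (\<Sum>i\<in>I. s i *\<^sub>R v' i)"
  define c where "c = V \<bullet> w"
  have V': "V' = V - c *\<^sub>R w"
    by (simp add: V'_def v'_def V_def c_def scaleR_right_diff_distrib sum_subtractf inner_sum_left scaleR_sum_left)
  have ww: "w \<bullet> w = 1" using assms(1) by (simp add: power2_norm_eq_inner[symmetric])
  have pyth: "(norm V)\<^sup>2 = (norm V')\<^sup>2 + c\<^sup>2"
    unfolding V' power2_norm_eq_inner using ww
    by (simp add: inner_diff_left inner_diff_right inner_commute[of w V] c_def[symmetric] power2_eq_square algebra_simps)
  have "expectation (\<lambda>\<omega>. cos (\<theta> + (\<Sum>i\<in>I. s i * X (v i) \<omega>))) = expectation (\<lambda>\<omega>. cos (\<theta> + X V \<omega>))"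
    using X_sum[OF assms(2), of s v] by (intro integral_cong_AE) (auto simp: V_def)
  then have 1: "expectation (\<lambda>\<omega>. cos (\<theta> + (\<Sum>i\<in>I. s i * X (v i) \<omega>))) = cos \<theta> * exp (- (norm V)\<^sup>2 / 2)"
    by (simp add: X_cos)
  have e: "(\<Sum>i\<in>I. s i * (X (v' i) \<omega> + t * (v i \<bullet> w))) = (\<Sum>i\<in>I. s i * X (v' i) \<omega>) + t * c" for \<omega> t
    by (simp add: c_def V_def inner_sum_left distrib_left sum.distrib sum_distrib_left mult_ac)
  have m: "(\<lambda>z. cos (\<theta> + (\<Sum>i\<in>I. s i * (X (v' i) (fst z) + snd z * (v i \<bullet> w))))) \<in>
      borel_measurable (M \<Otimes>\<^sub>M std_normal_distribution)"
    by measurable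
  then have i: "integrable (M \<Otimes>\<^sub>M std_normal_distribution)
    (\<lambda>(\<omega>, t). cos (\<theta> + (\<Sum>i\<in>I. s i * (X (v' i) \<omega> + t * (v i \<bullet> w)))))"
    by (intro P.integrable_const_bound[where B=1]) (auto simp: case_prod_beta')
  have "(LINT z|(M \<Otimes>\<^sub>M std_normal_distribution). cos (\<theta> + (\<Sum>i\<in>I. s i * (X (v' i) (fst z) + snd z * (v i \<bullet> w))))) =
    expectation (\<lambda>\<omega>. LINT t|std_normal_distribution. cos (\<theta> + (\<Sum>i\<in>I. s i * (X (v' i) \<omega> + t * (v i \<bullet> w)))))"
    using P.integral_fst'[OF i] by (simp add: case_prod_beta')
  also have "\<dots> = expectation (\<lambda>\<omega>. cos (\<theta> + (\<Sum>i\<in>I. s i * X (v' i) \<omega>)) * exp (- c\<^sup>2 / 2))"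
    unfolding e add.assoc[symmetric] std_normal_cos ..
  also have "\<dots> = expectation (\<lambda>\<omega>. cos (\<theta> + X V' \<omega>)) * exp (- c\<^sup>2 / 2)"
    using X_sum[OF assms(2), of s v'] by (simp, intro integral_cong_AE) (auto simp: V'_def)
  also have "\<dots> = cos \<theta> * exp (- (norm V)\<^sup>2 / 2)"
    by (simp add: X_cos pyth exp_add[symmetric] diff_divide_distrib)
  finally show "expectation (\<lambda>\<omega>. cos (\<theta> + (\<Sum>i\<in>I. s i * X (v i) \<omega>))) =
    (LINT z|(M \<Otimes>\<^sub>M std_normal_distribution).
      cos (\<theta> + (\<Sum>i\<in>I. s i * (X (v i - (v i \<bullet> w) *\<^sub>R w) (fst z) + snd z * (v i \<bullet> w)))))"
    using 1 by (simp add: v'_def)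
qed simp_all

end

section \<open>Gaussian integration by parts and the Malliavin derivative\<close>

lemma depends_on_first_partial_deriv:
  assumes "depends_on_first n f" "j < n"
  shows "depends_on_first n (partial_deriv j f)"
  unfolding depends_on_first_def
proof (intro allI impI)
  fix x y :: "nat \<Rightarrow> real" assume xy: "\<forall>i<n. x i = y i"
  have "f (x(j := t)) = f (y(j := t))" for t
    using assms(1) xy by (auto simp: depends_on_first_def)
  then show "partial_deriv j f x = partial_deriv j f y"
    using xy assms(2) by (simp add: partial_deriv_def)
qed

lemma polynomial_growth_along_line:
  fixes h :: "(nat \<Rightarrow> real) \<Rightarrow> real"
  assumes "\<And>x. \<bar>h x\<bar> \<le> A * (1 + (\<Sum>i<n. \<bar>x i\<bar>)) ^ m"
  shows "\<bar>h (\<lambda>i. x i + t * a i)\<bar> \<le> (\<bar>A\<bar> * (1 + (\<Sum>i<n. \<bar>x i\<bar> + \<bar>a i\<bar>)) ^ m) * (1 + \<bar>t\<bar>) ^ m"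
proof -
  let ?s = "\<Sum>i<n. \<bar>x i + t * a i\<bar>"
  have "\<bar>x i + t * a i\<bar> \<le> (\<bar>x i\<bar> + \<bar>a i\<bar>) * (1 + \<bar>t\<bar>)" for i
  proof -
    have "\<bar>x i + t * a i\<bar> \<le> \<bar>x i\<bar> + \<bar>t\<bar> * \<bar>a i\<bar>"
      using abs_triangle_ineq[of "x i" "t * a i"] by (simp add: abs_mult)
    moreover have "0 \<le> \<bar>x i\<bar> * \<bar>t\<bar>" by simp
    moreover have "(\<bar>x i\<bar> + \<bar>a i\<bar>) * (1 + \<bar>t\<bar>) = \<bar>x i\<bar> + \<bar>t\<bar> * \<bar>a i\<bar> + (\<bar>x i\<bar> * \<bar>t\<bar> + \<bar>a i\<bar>)"
      by (simp add: algebra_simps)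
    ultimately show ?thesis using abs_ge_zero[of "a i"] by linarith
  qed
  then have "?s \<le> (\<Sum>i<n. \<bar>x i\<bar> + \<bar>a i\<bar>) * (1 + \<bar>t\<bar>)"
    unfolding sum_distrib_right by (intro sum_mono)
  then have le: "1 + ?s \<le> (1 + (\<Sum>i<n. \<bar>x i\<bar> + \<bar>a i\<bar>)) * (1 + \<bar>t\<bar>)"
    by (simp add: distrib_right)
  have nn: "0 \<le> 1 + ?s" by (intro add_nonneg_nonneg sum_nonneg) auto
  have "\<bar>h (\<lambda>i. x i + t * a i)\<bar> \<le> A * (1 + ?s) ^ m" by (rule assms)
  also have "\<dots> \<le> \<bar>A\<bar> * (1 + ?s) ^ m" using nn by (intro mult_right_mono) auto
  also have "\<dots> \<le> \<bar>A\<bar> * ((1 + (\<Sum>i<n. \<bar>x i\<bar> + \<bar>a i\<bar>)) * (1 + \<bar>t\<bar>)) ^ m"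
    using le nn by (intro mult_left_mono power_mono) auto
  finally show ?thesis by (simp add: power_mult_distrib mult_ac)
qed

lemma smooth_poly_growthD:
  assumes "smooth_poly_growth n f"
  shows "depends_on_first n f" "continuous_on UNIV f"
    "\<And>i x. i < n \<Longrightarrow> (\<lambda>t. f (x(i := t))) differentiable (at (x i))"
    "\<exists>A m. \<forall>x. \<bar>f x\<bar> \<le> A * (1 + (\<Sum>i<n. \<bar>x i\<bar>)) ^ m"
    "\<And>j. j < n \<Longrightarrow> continuous_on UNIV (partial_deriv j f)"
    "\<And>j. j < n \<Longrightarrow> \<exists>A m. \<forall>x. \<bar>partial_deriv j f x\<bar> \<le> A * (1 + (\<Sum>i<n. \<bar>x i\<bar>)) ^ m"
proof -
  note d = assms[unfolded smooth_poly_growth_def]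
  from d show "depends_on_first n f" by blast
  from d have f: "continuous_on UNIV (iterated_partial js f) \<and>
      (\<forall>i<n. \<forall>x. (\<lambda>t. iterated_partial js f (x(i := t))) differentiable (at (x i))) \<and>
      (\<exists>A m. \<forall>x. \<bar>iterated_partial js f x\<bar> \<le> A * (1 + (\<Sum>i<n. \<bar>x i\<bar>)) ^ m)"
    if "set js \<subseteq> {..<n}" for js using that by blast
  show "continuous_on UNIV f" "\<And>i x. i < n \<Longrightarrow> (\<lambda>t. f (x(i := t))) differentiable (at (x i))"
    "\<exists>A m. \<forall>x. \<bar>f x\<bar> \<le> A * (1 + (\<Sum>i<n. \<bar>x i\<bar>)) ^ m"
    using f[of "[]"] by auto
  show "continuous_on UNIV (partial_deriv j f)"
    "\<exists>A m. \<forall>x. \<bar>partial_deriv j f x\<bar> \<le> A * (1 + (\<Sum>i<n. \<bar>x i\<bar>)) ^ m" if "j < n" for j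
    using f[of "[j]"] that by auto
qed

context isonormal
begin

text \<open>The decoupled law with $w$ itself added to the family, whose orthogonal component
  is $0$; this is where $X_0$ comes from. The exponent $k$ covers the functional alone ($k = 0$) and its product
  with $X_w$ ($k = 1$).\<close>

lemma decoupled_integral:
  fixes h :: "(nat \<Rightarrow> real) \<Rightarrow> real"
  defines "P \<equiv> M \<Otimes>\<^sub>M std_normal_distribution"
  assumes w: "norm w = 1" and h: "continuous_on UNIV h" "depends_on_first n h"
    and int: "integrable M (\<lambda>\<omega>. h (\<lambda>i. X (v i) \<omega>) * X w \<omega> ^ k)"
  shows "integrable P (\<lambda>z. h (\<lambda>i. X (v i - (v i \<bullet> w) *\<^sub>R w) (fst z) + snd z * (v i \<bullet> w)) * (X 0 (fst z) + snd z) ^ k)"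
    and "(LINT z|P. h (\<lambda>i. X (v i - (v i \<bullet> w) *\<^sub>R w) (fst z) + snd z * (v i \<bullet> w)) * (X 0 (fst z) + snd z) ^ k) =
      expectation (\<lambda>\<omega>. h (\<lambda>i. X (v i) \<omega>) * X w \<omega> ^ k)"
proof -
  let ?B = "Pi\<^sub>M {..n} (\<lambda>_. borel :: real measure)"
  \<comment> \<open>Index n carries w, so all coordinates that h reads come before it.\<close>
  define u where "u i = (if i < n then v i else w)" for i
  define Y where "Y \<omega> = (\<lambda>i\<in>{..n}. X (u i) \<omega>)" for \<omega>
  define Y' where "Y' z = (\<lambda>i\<in>{..n}. X (u i - (u i \<bullet> w) *\<^sub>R w) (fst z) + snd z * (u i \<bullet> w))" for z
  define g where "g y = h (\<lambda>i. if i < n then y i else 0) * y n ^ k" for y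
  have law: "distr M ?B Y = distr P ?B Y'"
    unfolding Y_def Y'_def P_def by (rule law_decoupled_along_unit_vector[OF w]) simp
  have [measurable]: "Y \<in> measurable M ?B" unfolding Y_def by (intro measurable_restrict) simp
  have [measurable]: "Y' \<in> measurable P ?B"
    unfolding Y'_def P_def by (intro measurable_restrict) measurable
  have "(\<lambda>y. (\<lambda>i. if i < n then y i else 0)) \<in> borel_measurable ?B"
  proof (rule measurable_coordinatewise_then_product)
    show "(\<lambda>y. if i < n then y i else 0) \<in> borel_measurable ?B" for i
      by (cases "i < n") (auto intro: measurable_component_singleton)
  qed
  then have [measurable]: "(\<lambda>y. h (\<lambda>i. if i < n then y i else 0)) \<in> borel_measurable ?B"
    using measurable_compose borel_measurable_continuous_onI[OF h(1)] by blast
  have [measurable]: "(\<lambda>y. y n) \<in> borel_measurable ?B" by (rule measurable_component_singleton) simp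
  have [measurable]: "g \<in> borel_measurable ?B" unfolding g_def by measurable
  have ww: "w \<bullet> w = 1" using w by (simp add: power2_norm_eq_inner[symmetric])
  have hh: "h (\<lambda>i. if i < n then p i else 0) = h q" if "\<And>i. i < n \<Longrightarrow> p i = q i" for p q
    using h(2) that by (auto simp: depends_on_first_def)
  have gY: "g (Y \<omega>) = h (\<lambda>i. X (v i) \<omega>) * X w \<omega> ^ k" for \<omega>
    unfolding g_def by (subst hh[of _ "\<lambda>i. X (v i) \<omega>"]) (auto simp: Y_def u_def)
  have gY': "g (Y' z) = h (\<lambda>i. X (v i - (v i \<bullet> w) *\<^sub>R w) (fst z) + snd z * (v i \<bullet> w)) * (X 0 (fst z) + snd z) ^ k" for z
    unfolding g_def by (subst hh[of _ "\<lambda>i. X (v i - (v i \<bullet> w) *\<^sub>R w) (fst z) + snd z * (v i \<bullet> w)"])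
      (auto simp: Y'_def u_def ww)
  have "integrable (distr M ?B Y) g" using int by (simp add: integrable_distr_eq gY)
  then have "integrable P (\<lambda>z. g (Y' z))" unfolding law by (simp add: integrable_distr_eq)
  then show "integrable P (\<lambda>z. h (\<lambda>i. X (v i - (v i \<bullet> w) *\<^sub>R w) (fst z) + snd z * (v i \<bullet> w)) * (X 0 (fst z) + snd z) ^ k)"
    by (simp add: gY')
  have "(LINT y|distr M ?B Y. g y) = expectation (\<lambda>\<omega>. g (Y \<omega>))" by (simp add: integral_distr)
  moreover have "(LINT y|distr P ?B Y'. g y) = (LINT z|P. g (Y' z))" by (simp add: integral_distr)
  ultimately show "(LINT z|P. h (\<lambda>i. X (v i - (v i \<bullet> w) *\<^sub>R w) (fst z) + snd z * (v i \<bullet> w)) * (X 0 (fst z) + snd z) ^ k) =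
      expectation (\<lambda>\<omega>. h (\<lambda>i. X (v i) \<omega>) * X w \<omega> ^ k)"
    by (simp add: law gY gY')
qed

text \<open>On the product space $X_w$ has become the normal variable $t$ of the second factor, up to the null
  variable $X_0$. For a fixed point of the first factor the integrand is $t$ times a function of $t$ of
  polynomial growth, whose derivative is $\sum_j (v_j, w) \partial_j f$.\<close>

lemma integration_by_parts_unit:
  assumes f: "smooth_poly_growth n f" and w: "norm w = 1"
  shows "expectation (\<lambda>\<omega>. f (\<lambda>i. X (v i) \<omega>) * X w \<omega>) =
    (\<Sum>j<n. (v j \<bullet> w) * expectation (\<lambda>\<omega>. partial_deriv j f (\<lambda>i. X (v i) \<omega>)))"
proof -
  interpret N: prob_space std_normal_distribution
    using real_dist_normal_dist by (simp add: real_distribution_def)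
  interpret P: pair_prob_space M std_normal_distribution ..
  note fD = smooth_poly_growthD[OF f]
  define a where "a i = v i \<bullet> w" for i
  define x where "x \<omega> = (\<lambda>i. X (v i - a i *\<^sub>R w) \<omega>)" for \<omega>
  obtain A m where A: "\<And>x. \<bar>f x\<bar> \<le> A * (1 + (\<Sum>i<n. \<bar>x i\<bar>)) ^ m" using fD(4) by blast
  obtain B l where B: "\<And>j x. j < n \<Longrightarrow> \<bar>partial_deriv j f x\<bar> \<le> B j * (1 + (\<Sum>i<n. \<bar>x i\<bar>)) ^ l j"
    using fD(6) by metis
  have mf: "(\<lambda>\<omega>. f (\<lambda>i. X (v i) \<omega>)) \<in> borel_measurable M"
    by (rule continuous_of_process_measurable[OF fD(2)])
  have "integrable M (\<lambda>\<omega>. f (\<lambda>i. X (v i) \<omega>) * X w \<omega>)"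
    by (rule integrable_product_of_square_integrable[OF mf X_measurable
          polynomial_growth_square_integrable[OF fD(2) A] X_square_integrable])
  then have "integrable M (\<lambda>\<omega>. f (\<lambda>i. X (v i) \<omega>) * X w \<omega> ^ 1)" by simp
  note F = decoupled_integral[OF w fD(2,1) this, folded a_def, unfolded power_one_right]
  have "integrable M (\<lambda>\<omega>. partial_deriv j f (\<lambda>i. X (v i) \<omega>) * X w \<omega> ^ 0)" if "j < n" for j
    using polynomial_growth_integrable[OF fD(5) B] that by simp
  note D = decoupled_integral[OF w fD(5) depends_on_first_partial_deriv[OF fD(1)] this, folded a_def, simplified power_0 mult_1_right]
  have F1: "integrable (M \<Otimes>\<^sub>M std_normal_distribution) (\<lambda>(\<omega>, t). f (\<lambda>i. x \<omega> i + t * a i) * (X 0 \<omega> + t))"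
    using F(1) by (simp add: x_def case_prod_beta')
  have F2: "expectation (\<lambda>\<omega>. f (\<lambda>i. X (v i) \<omega>) * X w \<omega>) =
    expectation (\<lambda>\<omega>. LINT t|std_normal_distribution. f (\<lambda>i. x \<omega> i + t * a i) * (X 0 \<omega> + t))"
    using F(2) P.integral_fst'[OF F1] by (simp add: x_def case_prod_beta')
  have D1: "integrable (M \<Otimes>\<^sub>M std_normal_distribution) (\<lambda>(\<omega>, t). partial_deriv j f (\<lambda>i. x \<omega> i + t * a i))"
    if "j < n" for j using D(1)[OF that that that] by (simp add: x_def case_prod_beta')
  have D2: "expectation (\<lambda>\<omega>. partial_deriv j f (\<lambda>i. X (v i) \<omega>)) =
    expectation (\<lambda>\<omega>. LINT t|std_normal_distribution. partial_deriv j f (\<lambda>i. x \<omega> i + t * a i))"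
    if "j < n" for j
    using D(2)[OF that that that] P.integral_fst'[OF D1[OF that]] by (simp add: x_def case_prod_beta')
  have D3: "integrable M (\<lambda>\<omega>. LINT t|std_normal_distribution. partial_deriv j f (\<lambda>i. x \<omega> i + t * a i))"
    if "j < n" for j using P.integrable_fst'[OF D1[OF that]] by simp
  have growth: "\<bar>f (\<lambda>i. y i + t * a i)\<bar> \<le> (\<bar>A\<bar> * (1 + (\<Sum>i<n. \<bar>y i\<bar> + \<bar>a i\<bar>)) ^ m) * (1 + \<bar>t\<bar>) ^ m" for y t
    by (rule polynomial_growth_along_line[OF A])
  have dgrowth: "\<bar>partial_deriv j f (\<lambda>i. y i + t * a i)\<bar> \<le> (\<bar>B j\<bar> * (1 + (\<Sum>i<n. \<bar>y i\<bar> + \<bar>a i\<bar>)) ^ l j) * (1 + \<bar>t\<bar>) ^ l j"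
    if "j < n" for j y t
    by (rule polynomial_growth_along_line[OF B[OF that]])
  have line: "continuous_on UNIV (\<lambda>t i. y i + t * a i)" for y :: "nat \<Rightarrow> real"
    by (intro continuous_on_coordinatewise_then_product continuous_intros)
  have dcont: "continuous_on UNIV (\<lambda>t. partial_deriv j f (\<lambda>i. y i + t * a i))" if "j < n" for j y
    using continuous_on_compose2[OF fD(5)[OF that] line] by simp
  have dint: "integrable std_normal_distribution (\<lambda>t. partial_deriv j f (\<lambda>i. y i + t * a i))" if "j < n" for j y
    using dcont[OF that] dgrowth[OF that]
    by (intro integrable_std_normal_polynomial_growth borel_measurable_continuous_onI) auto
  have ibp: "(LINT t|std_normal_distribution. t * f (\<lambda>i. y i + t * a i)) =
    (\<Sum>j<n. a j * (LINT t|std_normal_distribution. partial_deriv j f (\<lambda>i. y i + t * a i)))" for y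
  proof -
    \<comment> \<open>A common exponent and constant for the growth of all partial derivatives.\<close>
    define L where "L = (\<Sum>j<n. l j)"
    define C where "C = (\<Sum>j<n. \<bar>a j\<bar> * (\<bar>B j\<bar> * (1 + (\<Sum>i<n. \<bar>y i\<bar> + \<bar>a i\<bar>)) ^ l j))"
    have "(LINT t|std_normal_distribution. t * f (\<lambda>i. y i + t * a i)) =
      (LINT t|std_normal_distribution. (\<Sum>j<n. a j * partial_deriv j f (\<lambda>i. y i + t * a i)))"
    proof (rule std_normal_integration_by_parts)
      show "((\<lambda>t. f (\<lambda>i. y i + t * a i)) has_real_derivative (\<Sum>j<n. a j * partial_deriv j f (\<lambda>i. y i + t * a i))) (at t)" for t
        by (rule has_real_derivative_along_line[OF fD(1,5,3)])
      show "continuous_on UNIV (\<lambda>t. \<Sum>j<n. a j * partial_deriv j f (\<lambda>i. y i + t * a i))"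
        using dcont by (intro continuous_on_sum continuous_on_mult_left) auto
      show "\<bar>f (\<lambda>i. y i + t * a i)\<bar> \<le> (\<bar>A\<bar> * (1 + (\<Sum>i<n. \<bar>y i\<bar> + \<bar>a i\<bar>)) ^ m) * (1 + \<bar>t\<bar>) ^ m" for t
        by (rule growth)
      show "\<bar>\<Sum>j<n. a j * partial_deriv j f (\<lambda>i. y i + t * a i)\<bar> \<le> C * (1 + \<bar>t\<bar>) ^ L" for t
      proof -
        have "\<bar>a j * partial_deriv j f (\<lambda>i. y i + t * a i)\<bar> \<le>
          \<bar>a j\<bar> * (\<bar>B j\<bar> * (1 + (\<Sum>i<n. \<bar>y i\<bar> + \<bar>a i\<bar>)) ^ l j) * (1 + \<bar>t\<bar>) ^ L" if "j < n" for j
        proof -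
          have "l j \<le> L" unfolding L_def using that by (intro member_le_sum) auto
          then have "(1 + \<bar>t\<bar>) ^ l j \<le> (1 + \<bar>t\<bar>) ^ L" by (intro power_increasing) auto
          then have "(\<bar>B j\<bar> * (1 + (\<Sum>i<n. \<bar>y i\<bar> + \<bar>a i\<bar>)) ^ l j) * (1 + \<bar>t\<bar>) ^ l j \<le>
            (\<bar>B j\<bar> * (1 + (\<Sum>i<n. \<bar>y i\<bar> + \<bar>a i\<bar>)) ^ l j) * (1 + \<bar>t\<bar>) ^ L"
            by (intro mult_left_mono mult_nonneg_nonneg zero_le_power add_nonneg_nonneg sum_nonneg) auto
          with dgrowth[OF that, of y t]
          have "\<bar>partial_deriv j f (\<lambda>i. y i + t * a i)\<bar> \<le> (\<bar>B j\<bar> * (1 + (\<Sum>i<n. \<bar>y i\<bar> + \<bar>a i\<bar>)) ^ l j) * (1 + \<bar>t\<bar>) ^ L"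
            by (rule order_trans)
          then show ?thesis unfolding abs_mult mult.assoc by (intro mult_left_mono) auto
        qed
        then show ?thesis unfolding C_def sum_distrib_right
          by (intro order_trans[OF sum_abs] sum_mono) auto
      qed
    qed
    also have "\<dots> = (\<Sum>j<n. a j * (LINT t|std_normal_distribution. partial_deriv j f (\<lambda>i. y i + t * a i)))"
      using dint by (subst Bochner_Integration.integral_sum) auto
    finally show ?thesis .
  qed
  have "expectation (\<lambda>\<omega>. LINT t|std_normal_distribution. f (\<lambda>i. x \<omega> i + t * a i) * (X 0 \<omega> + t)) =
    expectation (\<lambda>\<omega>. \<Sum>j<n. a j * (LINT t|std_normal_distribution. partial_deriv j f (\<lambda>i. x \<omega> i + t * a i)))"
  proof (rule integral_cong_AE)
    show "(\<lambda>\<omega>. LINT t|std_normal_distribution. f (\<lambda>i. x \<omega> i + t * a i) * (X 0 \<omega> + t)) \<in> borel_measurable M"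
      using P.integrable_fst'[OF F1] by simp
    show "(\<lambda>\<omega>. \<Sum>j<n. a j * (LINT t|std_normal_distribution. partial_deriv j f (\<lambda>i. x \<omega> i + t * a i))) \<in> borel_measurable M"
      using D3 by (intro borel_measurable_sum borel_measurable_times) auto
    show "AE \<omega> in M. (LINT t|std_normal_distribution. f (\<lambda>i. x \<omega> i + t * a i) * (X 0 \<omega> + t)) =
      (\<Sum>j<n. a j * (LINT t|std_normal_distribution. partial_deriv j f (\<lambda>i. x \<omega> i + t * a i)))"
      using X_zero by eventually_elim (simp add: ibp mult.commute[of "f _"])
  qed
  also have "\<dots> = (\<Sum>j<n. a j * expectation (\<lambda>\<omega>. LINT t|std_normal_distribution. partial_deriv j f (\<lambda>i. x \<omega> i + t * a i)))"
    using D3 by (subst Bochner_Integration.integral_sum) auto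
  finally show ?thesis
    using D2 by (simp add: F2 a_def[symmetric])
qed

lemma integration_by_parts:
  assumes f: "smooth_poly_growth n f"
  shows "expectation (\<lambda>\<omega>. f (\<lambda>i. X (v i) \<omega>) * X w \<omega>) =
    (\<Sum>j<n. (v j \<bullet> w) * expectation (\<lambda>\<omega>. partial_deriv j f (\<lambda>i. X (v i) \<omega>)))"
proof -
  have [measurable]: "(\<lambda>\<omega>. f (\<lambda>i. X (v i) \<omega>)) \<in> borel_measurable M"
    by (rule continuous_of_process_measurable[OF smooth_poly_growthD(2)[OF f]])
  define u where "u = (if w = 0 then w else (1 / norm w) *\<^sub>R w)"
  have w: "w = norm w *\<^sub>R u" by (simp add: u_def)
  have "expectation (\<lambda>\<omega>. f (\<lambda>i. X (v i) \<omega>) * X w \<omega>) =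
      expectation (\<lambda>\<omega>. norm w * (f (\<lambda>i. X (v i) \<omega>) * X u \<omega>))"
    using X_scale[of "norm w" u] unfolding w[symmetric] by (intro integral_cong_AE) auto
  then have "expectation (\<lambda>\<omega>. f (\<lambda>i. X (v i) \<omega>) * X w \<omega>) =
      norm w * expectation (\<lambda>\<omega>. f (\<lambda>i. X (v i) \<omega>) * X u \<omega>)" by simp
  also have "\<dots> = (\<Sum>j<n. (v j \<bullet> w) * expectation (\<lambda>\<omega>. partial_deriv j f (\<lambda>i. X (v i) \<omega>)))"
  proof (cases "w = 0")
    case False
    then have "norm u = 1" by (simp add: u_def)
    then show ?thesis
      unfolding integration_by_parts_unit[OF f \<open>norm u = 1\<close>]
      by (subst (2) w) (simp add: sum_distrib_left mult_ac)
  qed simp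
  finally show ?thesis .
qed

text \<open>By the Cauchy-Schwarz inequality, integration against a square integrable function is continuous
  in $L^2$. This carries integration by parts over to the closure of $D$.\<close>

lemma L2_limit_integral:
  fixes f g :: "'w \<Rightarrow> real"
  assumes [measurable]: "\<And>k. fs k \<in> borel_measurable M" "f \<in> borel_measurable M" "g \<in> borel_measurable M"
    and sq: "\<And>k. integrable M (\<lambda>\<omega>. (fs k \<omega>)\<^sup>2)" "integrable M (\<lambda>\<omega>. (f \<omega>)\<^sup>2)" "integrable M (\<lambda>\<omega>. (g \<omega>)\<^sup>2)"
    and lim: "(\<lambda>k. \<integral>\<^sup>+\<omega>. ennreal ((fs k \<omega> - f \<omega>)\<^sup>2) \<partial>M) \<longlonglongrightarrow> 0"
  shows "(\<lambda>k. expectation (\<lambda>\<omega>. fs k \<omega> * g \<omega>)) \<longlonglongrightarrow> expectation (\<lambda>\<omega>. f \<omega> * g \<omega>)"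
proof -
  define d where "d k = expectation (\<lambda>\<omega>. fs k \<omega> * g \<omega>) - expectation (\<lambda>\<omega>. f \<omega> * g \<omega>)" for k
  define c where "c = (\<integral>\<^sup>+\<omega>. ennreal ((g \<omega>)\<^sup>2) \<partial>M)"
  have c: "c < top" unfolding c_def using sq(3) by (subst nn_integral_eq_integral) auto
  have i: "integrable M (\<lambda>\<omega>. fs k \<omega> * g \<omega>)" "integrable M (\<lambda>\<omega>. f \<omega> * g \<omega>)" for k
    using sq by (auto intro!: integrable_product_of_square_integrable)
  have bound: "ennreal ((d k)\<^sup>2) \<le> c * (\<integral>\<^sup>+\<omega>. ennreal ((fs k \<omega> - f \<omega>)\<^sup>2) \<partial>M)" for k
  proof -
    have "d k = expectation (\<lambda>\<omega>. (fs k \<omega> - f \<omega>) * g \<omega>)"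
      using i by (simp add: d_def left_diff_distrib)
    then have "ennreal \<bar>d k\<bar> \<le> (\<integral>\<^sup>+\<omega>. ennreal \<bar>(fs k \<omega> - f \<omega>) * g \<omega>\<bar> \<partial>M)"
      using integral_norm_bound_ennreal[of M "\<lambda>\<omega>. (fs k \<omega> - f \<omega>) * g \<omega>"] i by (simp add: left_diff_distrib)
    also have "\<dots> = (\<integral>\<^sup>+\<omega>. ennreal \<bar>fs k \<omega> - f \<omega>\<bar> * ennreal \<bar>g \<omega>\<bar> \<partial>M)"
      by (simp add: abs_mult ennreal_mult)
    finally have "(ennreal \<bar>d k\<bar>)\<^sup>2 \<le> (\<integral>\<^sup>+\<omega>. ennreal \<bar>fs k \<omega> - f \<omega>\<bar> * ennreal \<bar>g \<omega>\<bar> \<partial>M)\<^sup>2"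
      by (intro power_mono) auto
    also have "\<dots> \<le> (\<integral>\<^sup>+\<omega>. (ennreal \<bar>fs k \<omega> - f \<omega>\<bar>)\<^sup>2 \<partial>M) * (\<integral>\<^sup>+\<omega>. (ennreal \<bar>g \<omega>\<bar>)\<^sup>2 \<partial>M)"
      by (rule Cauchy_Schwarz_nn_integral) measurable
    finally show ?thesis by (simp add: ennreal_power c_def mult.commute)
  qed
  have lim0: "(\<lambda>k. c * (\<integral>\<^sup>+\<omega>. ennreal ((fs k \<omega> - f \<omega>)\<^sup>2) \<partial>M)) \<longlonglongrightarrow> 0"
    using ennreal_tendsto_cmult[OF c lim] by simp
  have "(\<lambda>k. ennreal ((d k)\<^sup>2)) \<longlonglongrightarrow> 0"
    by (rule tendsto_sandwich[OF _ _ tendsto_const lim0]) (intro always_eventually allI bound zero_le)+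
  then have "d \<longlonglongrightarrow> 0" by (simp add: ennreal_tendsto_0_iff)
  then show ?thesis unfolding d_def by (rule LIM_zero_cancel)
qed

end

text \<open>Both sides are continuous for the $L^2$ convergence that defines the closure of $D$, and for smooth
  functionals they agree by \<open>integration_by_parts\<close>.\<close>

lemma malliavin_derivative_duality:
  fixes X :: "'h::{real_inner, polish_space} \<Rightarrow> 'w \<Rightarrow> real"
  assumes "isonormal M X" and D: "has_malliavin_derivative M X \<phi> G"
  shows "(LINT \<omega>|M. \<phi> \<omega> * X w \<omega>) = (LINT \<omega>|M. G \<omega> \<bullet> w)"
proof -
  interpret isonormal M X by fact
  from D obtain \<phi>s Gs where smooth: "\<And>k :: nat. smooth_malliavin_derivative X (\<phi>s k) (Gs k)"
    and \<phi>lim: "(\<lambda>k. \<integral>\<^sup>+\<omega>. ennreal ((\<phi>s k \<omega> - \<phi> \<omega>)\<^sup>2) \<partial>M) \<longlonglongrightarrow> 0"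
    and Glim: "(\<lambda>k. \<integral>\<^sup>+\<omega>. ennreal ((norm (Gs k \<omega> - G \<omega>))\<^sup>2) \<partial>M) \<longlonglongrightarrow> 0"
    and [measurable]: "\<phi> \<in> borel_measurable M" "G \<in> borel_measurable M"
    and \<phi>sq: "integrable M (\<lambda>\<omega>. (\<phi> \<omega>)\<^sup>2)" and Gsq: "integrable M (\<lambda>\<omega>. (norm (G \<omega>))\<^sup>2)"
    unfolding has_malliavin_derivative_def by blast
  have approx: "\<phi>s k \<in> borel_measurable M \<and> Gs k \<in> borel_measurable M \<and>
      integrable M (\<lambda>\<omega>. (\<phi>s k \<omega>)\<^sup>2) \<and> integrable M (\<lambda>\<omega>. (Gs k \<omega> \<bullet> w)\<^sup>2) \<and>
      expectation (\<lambda>\<omega>. \<phi>s k \<omega> * X w \<omega>) = expectation (\<lambda>\<omega>. Gs k \<omega> \<bullet> w)" for k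
  proof -
    obtain n and v :: "nat \<Rightarrow> 'h" and f where f: "smooth_poly_growth n f"
      and \<phi>k: "\<phi>s k = (\<lambda>\<omega>. f (\<lambda>i. X (v i) \<omega>))"
      and Gk: "Gs k = (\<lambda>\<omega>. \<Sum>j<n. partial_deriv j f (\<lambda>i. X (v i) \<omega>) *\<^sub>R v j)"
      using smooth[of k] unfolding smooth_malliavin_derivative_def by blast
    note fD = smooth_poly_growthD[OF f]
    obtain A m where A: "\<And>x. \<bar>f x\<bar> \<le> A * (1 + (\<Sum>i<n. \<bar>x i\<bar>)) ^ m" using fD(4) by blast
    obtain B l where B: "\<And>j x. j < n \<Longrightarrow> \<bar>partial_deriv j f x\<bar> \<le> B j * (1 + (\<Sum>i<n. \<bar>x i\<bar>)) ^ l j"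
      using fD(6) by metis
    have md: "(\<lambda>\<omega>. partial_deriv j f (\<lambda>i. X (v i) \<omega>)) \<in> borel_measurable M" if "j < n" for j
      by (rule continuous_of_process_measurable[OF fD(5)[OF that]])
    have Gw: "Gs k \<omega> \<bullet> w = (\<Sum>j<n. (v j \<bullet> w) * partial_deriv j f (\<lambda>i. X (v i) \<omega>))" for \<omega>
      by (simp add: Gk inner_sum_left mult.commute)
    have pp: "integrable M (\<lambda>\<omega>. partial_deriv i f (\<lambda>i. X (v i) \<omega>) * partial_deriv j f (\<lambda>i. X (v i) \<omega>))"
      if "i < n" "j < n" for i j
      using that by (intro integrable_product_of_square_integrable md
          polynomial_growth_square_integrable[OF fD(5) B])
    have "integrable M (\<lambda>\<omega>. \<Sum>i<n. \<Sum>j<n. ((v i \<bullet> w) * (v j \<bullet> w)) *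
        (partial_deriv i f (\<lambda>i. X (v i) \<omega>) * partial_deriv j f (\<lambda>i. X (v i) \<omega>)))"
      using pp by (intro Bochner_Integration.integrable_sum integrable_mult_right) auto
    moreover have "(Gs k \<omega> \<bullet> w)\<^sup>2 = (\<Sum>i<n. \<Sum>j<n. ((v i \<bullet> w) * (v j \<bullet> w)) *
        (partial_deriv i f (\<lambda>i. X (v i) \<omega>) * partial_deriv j f (\<lambda>i. X (v i) \<omega>)))" for \<omega>
      unfolding Gw power2_eq_square sum_product by (simp add: mult_ac)
    ultimately have "integrable M (\<lambda>\<omega>. (Gs k \<omega> \<bullet> w)\<^sup>2)" by simp
    moreover have "Gs k \<in> borel_measurable M"
      unfolding Gk using md by (intro borel_measurable_sum borel_measurable_scaleR) auto
    moreover have "expectation (\<lambda>\<omega>. Gs k \<omega> \<bullet> w) =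
        (\<Sum>j<n. (v j \<bullet> w) * expectation (\<lambda>\<omega>. partial_deriv j f (\<lambda>i. X (v i) \<omega>)))"
      unfolding Gw using polynomial_growth_integrable[OF fD(5) B]
      by (subst Bochner_Integration.integral_sum) auto
    moreover have "expectation (\<lambda>\<omega>. \<phi>s k \<omega> * X w \<omega>) =
        (\<Sum>j<n. (v j \<bullet> w) * expectation (\<lambda>\<omega>. partial_deriv j f (\<lambda>i. X (v i) \<omega>)))"
      unfolding \<phi>k by (rule integration_by_parts[OF f])
    moreover have "\<phi>s k \<in> borel_measurable M" "integrable M (\<lambda>\<omega>. (\<phi>s k \<omega>)\<^sup>2)"
      unfolding \<phi>k using continuous_of_process_measurable[OF fD(2)]
        polynomial_growth_square_integrable[OF fD(2) A] by auto
    ultimately show ?thesis by simp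
  qed
  have [measurable]: "\<phi>s k \<in> borel_measurable M" "Gs k \<in> borel_measurable M" for k
    using approx by auto
  have cs: "(x \<bullet> w)\<^sup>2 \<le> (norm w)\<^sup>2 * (norm x)\<^sup>2" for x :: 'h
    using power_mono[OF Cauchy_Schwarz_ineq2[of x w] abs_ge_zero, of 2]
    by (simp add: power_mult_distrib mult.commute)
  have 1: "(\<lambda>k. expectation (\<lambda>\<omega>. \<phi>s k \<omega> * X w \<omega>)) \<longlonglongrightarrow> expectation (\<lambda>\<omega>. \<phi> \<omega> * X w \<omega>)"
    using approx \<phi>sq \<phi>lim X_square_integrable by (intro L2_limit_integral) auto
  have "integrable M (\<lambda>\<omega>. (norm w)\<^sup>2 * (norm (G \<omega>))\<^sup>2)" using Gsq by simp
  then have Gw2: "integrable M (\<lambda>\<omega>. (G \<omega> \<bullet> w)\<^sup>2)"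
    by (rule Bochner_Integration.integrable_bound) (auto simp: cs)
  have "(\<lambda>k. ennreal ((norm w)\<^sup>2) * (\<integral>\<^sup>+\<omega>. ennreal ((norm (Gs k \<omega> - G \<omega>))\<^sup>2) \<partial>M)) \<longlonglongrightarrow> ennreal ((norm w)\<^sup>2) * 0"
    by (intro ennreal_tendsto_cmult Glim) simp
  then have lim0: "(\<lambda>k. ennreal ((norm w)\<^sup>2) * (\<integral>\<^sup>+\<omega>. ennreal ((norm (Gs k \<omega> - G \<omega>))\<^sup>2) \<partial>M)) \<longlonglongrightarrow> 0"
    by simp
  have le: "(\<integral>\<^sup>+\<omega>. ennreal ((Gs k \<omega> \<bullet> w - G \<omega> \<bullet> w)\<^sup>2) \<partial>M) \<le>
      ennreal ((norm w)\<^sup>2) * (\<integral>\<^sup>+\<omega>. ennreal ((norm (Gs k \<omega> - G \<omega>))\<^sup>2) \<partial>M)" for k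
  proof -
    have "ennreal ((Gs k \<omega> \<bullet> w - G \<omega> \<bullet> w)\<^sup>2) \<le> ennreal ((norm w)\<^sup>2) * ennreal ((norm (Gs k \<omega> - G \<omega>))\<^sup>2)" for \<omega>
      unfolding inner_diff_left[symmetric] ennreal_mult[OF zero_le_power2 zero_le_power2, symmetric]
      by (rule ennreal_leI[OF cs])
    then have "(\<integral>\<^sup>+\<omega>. ennreal ((Gs k \<omega> \<bullet> w - G \<omega> \<bullet> w)\<^sup>2) \<partial>M) \<le>
        (\<integral>\<^sup>+\<omega>. ennreal ((norm w)\<^sup>2) * ennreal ((norm (Gs k \<omega> - G \<omega>))\<^sup>2) \<partial>M)"
      by (rule nn_integral_mono)
    then show ?thesis by (subst (asm) nn_integral_cmult) measurable
  qed
  have "(\<lambda>k. \<integral>\<^sup>+\<omega>. ennreal ((Gs k \<omega> \<bullet> w - G \<omega> \<bullet> w)\<^sup>2) \<partial>M) \<longlonglongrightarrow> 0"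
    by (rule tendsto_sandwich[OF _ _ tendsto_const lim0]) (intro always_eventually allI le zero_le)+
  then have 2: "(\<lambda>k. expectation (\<lambda>\<omega>. (Gs k \<omega> \<bullet> w) * 1)) \<longlonglongrightarrow> expectation (\<lambda>\<omega>. (G \<omega> \<bullet> w) * 1)"
    using approx Gw2 by (intro L2_limit_integral) auto
  have "expectation (\<lambda>\<omega>. \<phi>s k \<omega> * X w \<omega>) = expectation (\<lambda>\<omega>. (Gs k \<omega> \<bullet> w) * 1)" for k
    using approx[of k] by simp
  from LIMSEQ_unique[OF 1[unfolded this] 2] show ?thesis by simp
qed

section \<open>Support functions and the Steiner point\<close>

text \<open>Where the family is unbounded, no real number is an upper bound, so all such suprema are one and
  the same default value: the least element of the empty predicate.\<close>

lemma borel_measurable_real_cSUP: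
  fixes F :: "'i \<Rightarrow> 'a \<Rightarrow> real"
  assumes "countable I" and [measurable]: "\<And>i. i \<in> I \<Longrightarrow> F i \<in> borel_measurable M"
  shows "(\<lambda>x. SUP i\<in>I. F i x) \<in> borel_measurable M"
proof -
  define B where "B x \<longleftrightarrow> (\<exists>n::nat. \<forall>i\<in>I. F i x \<le> real n)" for x
  have bdd: "bdd_above ((\<lambda>i. F i x) ` I) \<longleftrightarrow> B x" for x
  proof
    assume "bdd_above ((\<lambda>i. F i x) ` I)"
    then obtain c where c: "\<And>i. i \<in> I \<Longrightarrow> F i x \<le> c" by (auto simp: bdd_above_def)
    obtain n :: nat where "c \<le> real n" using real_arch_simple by blast
    with c show "B x" unfolding B_def by (meson order_trans)
  qed (auto simp: B_def bdd_above_def)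
  have [measurable]: "Measurable.pred M B"
    unfolding B_def using assms(1) by measurable
  have "(\<lambda>x. SUP i\<in>I. if B x then F i x else 0) \<in> borel_measurable M"
  proof (rule borel_measurable_cSUP[OF assms(1)])
    show "bdd_above ((\<lambda>i. if B x then F i x else 0) ` I)" for x
      using bdd[of x] by (cases "B x") (auto simp: bdd_above_def)
  qed measurable
  then have "(\<lambda>x. if B x then SUP i\<in>I. if B x then F i x else 0 else (LEAST z::real. False)) \<in> borel_measurable M"
    by measurable
  moreover have "(SUP i\<in>I. F i x) = (if B x then SUP i\<in>I. if B x then F i x else 0 else (LEAST z. False))" for x
  proof (cases "B x")
    case False
    then have "(\<forall>y\<in>(\<lambda>i. F i x) ` I. y \<le> z) = False" for z using bdd[of x] by (auto simp: bdd_above_def)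
    then show ?thesis using False by (simp only: Sup_real_def if_False)
  qed simp
  ultimately show ?thesis by simp
qed

context isonormal
begin

lemma X_integrable_product: "integrable M (\<lambda>\<omega>. X v \<omega> * X u \<omega>)"
  by (intro integrable_product_of_square_integrable X_square_integrable X_measurable)

lemma X_increment: "expectation (\<lambda>\<omega>. (X v \<omega> - X u \<omega>)\<^sup>2) = (norm (v - u))\<^sup>2"
proof -
  have "(\<lambda>\<omega>. (X v \<omega> - X u \<omega>)\<^sup>2) = (\<lambda>\<omega>. X v \<omega> * X v \<omega> - 2 * (X v \<omega> * X u \<omega>) + X u \<omega> * X u \<omega>)"
    by (auto simp: power2_eq_square algebra_simps)
  then show ?thesis
    using X_integrable_product
    by (simp add: X_covariance power2_norm_eq_inner inner_diff_left inner_diff_right inner_commute)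
qed

text \<open>If $u_n \to v$ then $X_{u_n} \to X_v$ in $L^2$, since $E[(X_{u_n} - X_v)^2] = \|u_n - v\|^2$, and
  therefore almost surely along a subsequence.\<close>

lemma X_le_SUP_dense:
  assumes v: "v \<in> closure C"
  shows "AE \<omega> in M. bdd_above ((\<lambda>v. X v \<omega>) ` C) \<longrightarrow> X v \<omega> \<le> (SUP v\<in>C. X v \<omega>)"
proof -
  obtain u where u: "\<And>n. u n \<in> C" "u \<longlonglongrightarrow> v" using v unfolding closure_sequential by blast
  have int: "integrable M (\<lambda>\<omega>. (X (u n) \<omega> - X v \<omega>)\<^sup>2)" for n
  proof -
    have "(\<lambda>\<omega>. (X (u n) \<omega> - X v \<omega>)\<^sup>2) =
        (\<lambda>\<omega>. X (u n) \<omega> * X (u n) \<omega> - 2 * (X (u n) \<omega> * X v \<omega>) + X v \<omega> * X v \<omega>)"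
      by (auto simp: power2_eq_square algebra_simps)
    then show ?thesis using X_integrable_product by simp
  qed
  have "(\<lambda>n. (norm (u n - v))\<^sup>2) \<longlonglongrightarrow> 0"
    using u(2) LIM_zero[of u v] by (simp add: tendsto_norm_zero)
  then have "(\<lambda>n. expectation (\<lambda>\<omega>. norm ((X (u n) \<omega> - X v \<omega>)\<^sup>2))) \<longlonglongrightarrow> 0"
    by (simp add: X_increment)
  from tendsto_L1_AE_subseq[OF int this] obtain r
    where "AE \<omega> in M. (\<lambda>n. (X (u (r n)) \<omega> - X v \<omega>)\<^sup>2) \<longlonglongrightarrow> 0" by blast
  then show ?thesis
  proof eventually_elim
    case (elim \<omega>)
    then have "(\<lambda>n. X (u (r n)) \<omega>) \<longlonglongrightarrow> X v \<omega>" by (simp add: LIM_zero_iff)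
    note lim = this
    show ?case
    proof
      assume "bdd_above ((\<lambda>v. X v \<omega>) ` C)"
      then have "X (u (r n)) \<omega> \<le> (SUP v\<in>C. X v \<omega>)" for n by (rule cSUP_upper[OF u(1)])
      then show "X v \<omega> \<le> (SUP v\<in>C. X v \<omega>)" by (intro LIMSEQ_le_const2[OF lim] exI allI impI)
    qed
  qed
qed

text \<open>Each of the two suprema almost surely dominates every single variable of the other countable
  family.\<close>

lemma support_function_AE_unique:
  assumes GB: "gaussian_bounded M X K" and "K \<noteq> {}"
    and C: "countable_dense_subset C K" and D: "countable_dense_subset D K"
  shows "AE \<omega> in M. support_function X C \<omega> = support_function X D \<omega>"
proof -
  have le: "AE \<omega> in M. support_function X D \<omega> \<le> support_function X C \<omega>"
    if C: "countable_dense_subset C K" and D: "countable_dense_subset D K" for C D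
  proof -
    have "D \<noteq> {}" using D \<open>K \<noteq> {}\<close> by (auto simp: countable_dense_subset_def)
    have "AE \<omega> in M. bdd_above ((\<lambda>v. X v \<omega>) ` C)"
      using GB C by (auto simp: gaussian_bounded_def countable_dense_subset_def)
    moreover have "AE \<omega> in M. \<forall>v\<in>D. bdd_above ((\<lambda>v. X v \<omega>) ` C) \<longrightarrow> X v \<omega> \<le> (SUP v\<in>C. X v \<omega>)"
      using C D by (intro AE_ball_countable' X_le_SUP_dense) (auto simp: countable_dense_subset_def)
    ultimately show ?thesis
      unfolding support_function_def
    proof eventually_elim
      case (elim \<omega>)
      then have "X v \<omega> \<le> (SUP v\<in>C. X v \<omega>)" if "v \<in> D" for v using that by blast
      then show ?case by (rule cSUP_least[OF \<open>D \<noteq> {}\<close>])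
    qed
  qed
  show ?thesis using le[OF C D] le[OF D C] by eventually_elim simp
qed

lemma support_function_measurable:
  assumes "countable C"
  shows "support_function X C \<in> borel_measurable M"
  unfolding support_function_def[abs_def] using assms by (intro borel_measurable_real_cSUP X_measurable)

end

theorem proposition4p14:
  fixes M :: "'w measure"
    and X :: "'h::{real_inner,polish_space} \<Rightarrow> 'w \<Rightarrow> real"
    and K C :: "'h set"
    and G :: "'w \<Rightarrow> 'h"
  assumes "\<not> (\<exists>B :: 'h set. finite B \<and> span B = UNIV)"
    and "prob_space M"
    and "isonormal_gaussian_process M X"
    and "convex_body K"
    and "gaussian_bounded M X K"
    and "countable_dense_subset C K"
    and "has_malliavin_derivative M X (support_function X C) G"
    and "AE \<omega> in M. G \<omega> \<in> extremal_points K"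
  shows "is_barycenter K (law_on_extremal_points M K G) (steiner_point M X K)"
proof -
  interpret isonormal M X
    by (intro isonormal.intro isonormal_axioms.intro assms(2,3))
  have K: "K \<noteq> {}" "compact K" "convex K" using assms(4) by (auto simp: convex_body_def)
  have G[measurable]: "G \<in> borel_measurable M"
    using assms(7) by (simp add: has_malliavin_derivative_def)
  let ?E = "extremal_points K"
  have E[measurable]: "?E \<in> sets borel" using K by (intro extremal_points_borel)
  have "AE \<omega> in M. G \<omega> \<in> K"
    using assms(8) by eventually_elim (simp add: extremal_points_def extreme_point_of_def)
  from barycenter_exists[OF K(2,3) G this] obtain s where s: "s \<in> K" and rep: "\<And>\<phi>. affine_function \<phi> \<Longrightarrow> continuous_on UNIV \<phi> \<Longrightarrow>
      integrable M (\<lambda>\<omega>. \<phi> (G \<omega>)) \<and> expectation (\<lambda>\<omega>. \<phi> (G \<omega>)) = \<phi> s"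
    by blast
  have aff: "affine_function (\<lambda>x. x \<bullet> v)" "continuous_on UNIV (\<lambda>x. x \<bullet> v)" for v :: 'h
    by (auto simp: affine_function_def inner_add_left intro!: continuous_intros)
  \<comment> \<open>The barycenter of the law satisfies the equations that determine the Steiner point.\<close>
  have h: "s \<bullet> v = expectation (\<lambda>\<omega>. support_function X D \<omega> * X v \<omega>)" if D: "countable_dense_subset D K" for D v
  proof -
    have [measurable]: "support_function X D \<in> borel_measurable M" "support_function X C \<in> borel_measurable M"
      using D assms(6) by (auto intro!: support_function_measurable simp: countable_dense_subset_def)
    have "expectation (\<lambda>\<omega>. support_function X D \<omega> * X v \<omega>) = expectation (\<lambda>\<omega>. support_function X C \<omega> * X v \<omega>)"
      using support_function_AE_unique[OF assms(5) K(1) D assms(6)] by (intro integral_cong_AE) auto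
    also have "\<dots> = expectation (\<lambda>\<omega>. G \<omega> \<bullet> v)"
      by (rule malliavin_derivative_duality[OF isonormal_axioms assms(7)])
    finally show ?thesis using rep[OF aff, of v] by simp
  qed
  have stein: "steiner_point M X K = s"
    unfolding steiner_point_def
  proof (rule the_equality)
    fix s' assume "\<forall>D. countable_dense_subset D K \<longrightarrow> (\<forall>v. s' \<bullet> v = expectation (\<lambda>\<omega>. support_function X D \<omega> * X v \<omega>))"
    then have "s' \<bullet> v = s \<bullet> v" for v using h assms(6) by metis
    then show "s' = s" using vector_eq_rdot by blast
  qed (use h in blast)
  let ?\<mu> = "law_on_extremal_points M K G"
  have \<mu>: "integrable ?\<mu> \<phi> \<and> (LINT v|?\<mu>. \<phi> v) = expectation (\<lambda>\<omega>. \<phi> (G \<omega>))"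
    if \<phi>: "affine_function \<phi>" "continuous_on UNIV \<phi>" for \<phi>
  proof -
    have [measurable]: "\<phi> \<in> borel_measurable borel" using \<phi>(2) by (rule borel_measurable_continuous_onI)
    have ae: "AE \<omega> in M. indicator ?E (G \<omega>) *\<^sub>R \<phi> (G \<omega>) = \<phi> (G \<omega>)"
      using assms(8) by eventually_elim simp
    have "integrable M (\<lambda>\<omega>. indicator ?E (G \<omega>) *\<^sub>R \<phi> (G \<omega>))"
    proof (rule integrable_cong_AE_imp)
      show "integrable M (\<lambda>\<omega>. \<phi> (G \<omega>))" using rep[OF \<phi>] by blast
      show "AE \<omega> in M. \<phi> (G \<omega>) = indicator ?E (G \<omega>) *\<^sub>R \<phi> (G \<omega>)"
        using ae by eventually_elim simp
    qed measurable
    moreover have "expectation (\<lambda>\<omega>. indicator ?E (G \<omega>) *\<^sub>R \<phi> (G \<omega>)) = expectation (\<lambda>\<omega>. \<phi> (G \<omega>))"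
      by (rule integral_cong_AE[OF _ _ ae]) measurable
    ultimately show ?thesis
      by (simp add: law_on_extremal_points_def integrable_restrict_space integral_restrict_space
          integrable_distr_eq integral_distr)
  qed
  have sp: "space ?\<mu> = ?E" by (simp add: law_on_extremal_points_def space_restrict_space)
  have "emeasure ?\<mu> ?E = emeasure M (G -` ?E \<inter> space M)"
    by (simp add: law_on_extremal_points_def emeasure_restrict_space emeasure_distr)
  also have "\<dots> = 1"
    using assms(8) by (intro emeasure_eq_1_AE) auto
  finally have "prob_space ?\<mu>" using sp by (intro prob_spaceI) simp
  moreover have "represents_barycenter ?\<mu> s"
    unfolding represents_barycenter_def
  proof (intro allI impI, elim conjE)
    fix \<phi> :: "'h \<Rightarrow> real" assume \<phi>: "affine_function \<phi>" "continuous_on UNIV \<phi>"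
    show "integrable ?\<mu> \<phi> \<and> (LINT v|?\<mu>. \<phi> v) = \<phi> s"
      using \<mu>[OF \<phi>] rep[OF \<phi>] by simp
  qed
  moreover have "b = s" if "represents_barycenter ?\<mu> b" for b
  proof -
    have "b \<bullet> v = s \<bullet> v" for v
    proof -
      have "(LINT x|?\<mu>. x \<bullet> v) = b \<bullet> v" using that aff unfolding represents_barycenter_def by blast
      then show ?thesis using \<mu>[OF aff, of v] rep[OF aff, of v] by simp
    qed
    then show ?thesis using vector_eq_rdot by blast
  qed
  ultimately show ?thesis
    unfolding is_barycenter_def stein using sp s by blast
qed

end
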